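(* (Existence of global isothermal coordinates.) Let $\phi\colon\mathbb{R}^2\to\mathbb{R}^{1+2}$ be a smooth, proper, timelike immersion with vanishing mean curvature. Then there exists a smooth diffeomorphism $\psi\colon\mathbb{R}^2\to\mathbb{R}^2$ such that $\phi'=\phi\circ\psi$ is of the form $\phi'(s,t)=(t,\gamma^1(s,t),\gamma^2(s,t))$, where $\gamma=(\gamma^1,\gamma^2)$ satisfies $$\langle\gamma_s,\gamma_t\rangle=0,\qquad|\gamma_s|^2+|\gamma_t|^2=1,\qquad\gamma_{tt}-\gamma_{ss}=0$$ on $\mathbb{R}^2$.
   Context: $\mathbb{R}^{1+2}$ is $\mathbb{R}^3$ with coordinates $(x^0,x^1,x^2)$ and the Minkowski metric $\eta=-(dx^0)^2+(dx^1)^2+(dx^2)^2$; $\langle\cdot,\cdot\rangle$ and $|\cdot|$ are Euclidean on $\mathbb{R}^2$. An immersion $\phi$ with induced form $g=\phi^*\eta$ is timelike if $\det g<0$ everywhere. For a $C^2$ timelike immersion, vanishing mean curvature means that the mean curvature vector is zero, equivalently $\frac{1}{\sqrt{|\det g|}}\partial_i\big(\sqrt{|\det g|}\,g^{ij}\partial_j\phi^\alpha\big)=0$ for $\alpha=0,1,2$. *)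

theory Defs
  imports "HOL-Analysis.Analysis"
begin

text \<open>
  Points of the parameter plane are written in coordinates as \<open>vector [s, t] :: real ^ 2\<close>, so that
  the coordinate directions are \<open>1\<close> (for \<open>s\<close>) and \<open>2\<close> (for \<open>t\<close>).  The space \<open>\<real>\<^sup>1\<^sup>+\<^sup>2\<close> is
  \<open>real ^ 3\<close>, with the coordinates \<open>x\<^sup>0, x\<^sup>1, x\<^sup>2\<close> stored at the indices \<open>1, 2, 3\<close>.
\<close>

text \<open>
  A map is of class \<open>C\<^sup>k\<^sup>+\<^sup>1\<close> iff it is differentiable and all its directional derivatives
  are of class \<open>C\<^sup>k\<close>; in finite dimension this agrees with the usual notion.
\<close>

primrec class_C :: "nat \<Rightarrow> ('a::euclidean_space \<Rightarrow> 'b::euclidean_space) \<Rightarrow> bool" where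
  "class_C 0 f \<longleftrightarrow> continuous_on UNIV f"
| "class_C (Suc k) f \<longleftrightarrow>
     (\<forall>x. f differentiable (at x)) \<and> (\<forall>v. class_C k (\<lambda>x. frechet_derivative f (at x) v))"

definition smooth :: "('a::euclidean_space \<Rightarrow> 'b::euclidean_space) \<Rightarrow> bool" where
  "smooth f \<longleftrightarrow> (\<forall>k. class_C k f)"

definition smooth_diffeomorphism :: "('a::euclidean_space \<Rightarrow> 'b::euclidean_space) \<Rightarrow> bool" where
  "smooth_diffeomorphism f \<longleftrightarrow> bij f \<and> smooth f \<and> smooth (inv f)"

definition immersion :: "('a::euclidean_space \<Rightarrow> 'b::euclidean_space) \<Rightarrow> bool" where
  "immersion f \<longleftrightarrow> (\<forall>x. f differentiable (at x) \<and> inj (frechet_derivative f (at x)))"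

definition partial :: "'n::finite \<Rightarrow> (real ^ 'n \<Rightarrow> 'b::real_normed_vector) \<Rightarrow> real ^ 'n \<Rightarrow> 'b" where
  "partial i f p = frechet_derivative f (at p) (axis i 1)"

definition minkowski :: "real ^ 3 \<Rightarrow> real ^ 3 \<Rightarrow> real" where
  "minkowski u v = - (u $ 1 * v $ 1) + u $ 2 * v $ 2 + u $ 3 * v $ 3"

definition induced_form :: "(real ^ 2 \<Rightarrow> real ^ 3) \<Rightarrow> real ^ 2 \<Rightarrow> real ^ 2 ^ 2" where
  "induced_form \<phi> p = (\<chi> i j. minkowski (partial i \<phi> p) (partial j \<phi> p))"

definition timelike :: "(real ^ 2 \<Rightarrow> real ^ 3) \<Rightarrow> bool" where
  "timelike \<phi> \<longleftrightarrow> (\<forall>p. det (induced_form \<phi> p) < 0)"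

text \<open>
  The tangential part of \<open>v\<close> is \<open>g\<^sup>k\<^sup>l \<eta>(v, \<partial>\<^sub>l \<phi>) \<partial>\<^sub>k \<phi>\<close>, and \<open>normal_part\<close> removes it.
  All of the following is meaningful only where the induced form is nondegenerate.
\<close>

definition normal_part :: "(real ^ 2 \<Rightarrow> real ^ 3) \<Rightarrow> real ^ 2 \<Rightarrow> real ^ 3 \<Rightarrow> real ^ 3" where
  "normal_part \<phi> p v =
     v - (\<Sum>k\<in>UNIV. \<Sum>l\<in>UNIV.
            (matrix_inv (induced_form \<phi> p) $ k $ l * minkowski v (partial l \<phi> p)) *\<^sub>R partial k \<phi> p)"

definition second_fundamental_form ::
    "(real ^ 2 \<Rightarrow> real ^ 3) \<Rightarrow> real ^ 2 \<Rightarrow> 2 \<Rightarrow> 2 \<Rightarrow> real ^ 3" where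
  "second_fundamental_form \<phi> p i j = normal_part \<phi> p (partial i (partial j \<phi>) p)"

text \<open>
  The trace of the second fundamental form, without a factor \<open>1/2\<close>.  For a timelike \<open>\<phi>\<close> of class
  \<open>C\<^sup>2\<close> its component \<open>\<alpha>\<close> equals \<open>|det g|\<^bsup>-1/2\<^esup> \<partial>\<^sub>i (|det g|\<^bsup>1/2\<^esup> g\<^sup>i\<^sup>j \<partial>\<^sub>j \<phi>\<^sup>\<alpha>)\<close>.
\<close>

definition mean_curvature_vector :: "(real ^ 2 \<Rightarrow> real ^ 3) \<Rightarrow> real ^ 2 \<Rightarrow> real ^ 3" where
  "mean_curvature_vector \<phi> p =
     (\<Sum>i\<in>UNIV. \<Sum>j\<in>UNIV.
        matrix_inv (induced_form \<phi> p) $ i $ j *\<^sub>R second_fundamental_form \<phi> p i j)"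

definition vanishing_mean_curvature :: "(real ^ 2 \<Rightarrow> real ^ 3) \<Rightarrow> bool" where
  "vanishing_mean_curvature \<phi> \<longleftrightarrow> (\<forall>p. mean_curvature_vector \<phi> p = 0)"

end

theory Submission
  imports Defs
begin

text \<open>
  Vanishing mean curvature makes \<open>|det g|\<^bsup>1/2\<^esup> g\<^sup>i\<^sup>j \<partial>\<^sub>j \<phi>\<close> divergence free, so on the plane it has a
  conjugate \<open>Y\<close>.  The map \<open>(Y\<^sup>0, \<phi>\<^sup>0)\<close> is a local diffeomorphism because \<open>\<phi>\<close> is timelike, and in the
  coordinates \<open>(s, t)\<close> it defines \<open>g\<close> is conformal to \<open>- dt\<^sup>2 + ds\<^sup>2\<close>.  Hence \<open>|\<gamma>\<^sub>s|\<^sup>2 + |\<gamma>\<^sub>t|\<^sup>2 = 1\<close>, so that \<open>\<phi>\<close>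
  is Lipschitz in these coordinates, and together with properness this allows local inverses to be
  continued to the whole plane.  The wave equation follows from the conjugacy relations
  \<open>Y\<^sub>s = \<phi>\<^sub>t\<close>, \<open>Y\<^sub>t = \<phi>\<^sub>s\<close> and the symmetry of second derivatives.
\<close>

section \<open>Calculus of class \<open>C\<^sup>k\<close> maps\<close>

text \<open>The coordinates are essentially forced. The time function must be \<open>t\<close>;
  vanishing mean curvature makes it a solution of the wave equation of g, and in two dimensions
  \<open>s\<close> can then only be a conjugate of it, up to sign and an additive constant.

  The real obstacle is global. What survives is a bound of the derivative of \<phi> by that of the
  chart. It keeps \<phi> bounded on any lift of a bounded ball, properness then traps the lift in a
  compact set, and on that set the missing bound on the inverse derivative comes from
  compactness.\<close>

lemma class_C_SucI:
  assumes "\<And>x. (f has_derivative f' x) (at x)" "\<And>v. class_C k (\<lambda>x. f' x v)"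
  shows "class_C (Suc k) f"
proof -
  have "frechet_derivative f (at x) = f' x" for x
    using frechet_derivative_at[OF assms(1)] by simp
  then show ?thesis
    using assms by (auto simp: differentiable_def)
qed

lemma class_C_Suc_has_derivative:
  "class_C (Suc k) f \<Longrightarrow> (f has_derivative frechet_derivative f (at x)) (at x)"
  by (simp add: frechet_derivative_works)

lemma class_C_SucD: "class_C (Suc k) f \<Longrightarrow> class_C k f"
proof (induction k arbitrary: f)
  case 0
  then show ?case
    by (simp add: continuous_at_imp_continuous_on differentiable_imp_continuous_within)
next
  case (Suc k)
  show ?case
    by (rule class_C_SucI[OF class_C_Suc_has_derivative[OF Suc.prems]])
       (use Suc in auto)
qed

lemma class_C_imp_continuous: "class_C k f \<Longrightarrow> continuous_on S f"
  by (induction k) (auto dest: class_C_SucD intro: continuous_on_subset simp del: class_C.simps(2))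

lemma class_C_const [intro]: "class_C k (\<lambda>x. c)"
  by (induction k arbitrary: c) auto

lemma class_C_bounded_linear:
  assumes "bounded_linear f" shows "class_C k f"
proof (cases k)
  case 0
  then show ?thesis using assms by (simp add: linear_continuous_on)
next
  case (Suc l)
  show ?thesis unfolding Suc
    by (rule class_C_SucI[OF bounded_linear_imp_has_derivative[OF assms]]) auto
qed

lemma class_C_add:
  "class_C k f \<Longrightarrow> class_C k g \<Longrightarrow> class_C k (\<lambda>x. f x + g x)"
proof (induction k arbitrary: f g)
  case 0
  then show ?case by (simp add: continuous_on_add)
next
  case (Suc k)
  show ?case
    by (rule class_C_SucI[OF has_derivative_add[OF Suc.prems[THEN class_C_Suc_has_derivative]]])
       (use Suc in auto)
qed

text \<open>The derivative is a sum of two terms of the same bilinear shape, so the induction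
  closes. One product rule thus serves scalar multiples, products, inner products and later the
  Minkowski form.\<close>

lemma class_C_bilinear:
  assumes "bounded_bilinear B"
  shows "class_C k f \<Longrightarrow> class_C k g \<Longrightarrow> class_C k (\<lambda>x. B (f x) (g x))"
proof (induction k arbitrary: f g)
  case 0
  then show ?case by (simp add: bounded_bilinear.continuous_on[OF assms])
next
  case (Suc k)
  show ?case
    by (rule class_C_SucI[OF bounded_bilinear.FDERIV[OF assms Suc.prems[THEN class_C_Suc_has_derivative]]])
       (use Suc Suc.prems[THEN class_C_SucD] in \<open>auto intro!: class_C_add\<close>)
qed

lemmas class_C_scaleR = class_C_bilinear[OF bounded_bilinear_scaleR]
lemmas class_C_mult = class_C_bilinear[OF bounded_bilinear_mult]
  and class_C_inner = class_C_bilinear[OF bounded_bilinear_inner]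

lemma class_C_minus: "class_C k f \<Longrightarrow> class_C k (\<lambda>x. - f x)"
  using class_C_scaleR[OF class_C_const[of k "-1"]] by simp

lemma class_C_diff: "class_C k f \<Longrightarrow> class_C k g \<Longrightarrow> class_C k (\<lambda>x. f x - g x)"
  using class_C_add[OF _ class_C_minus] by simp

lemma class_C_sum: "(\<And>i. i \<in> I \<Longrightarrow> class_C k (f i)) \<Longrightarrow> class_C k (\<lambda>x. \<Sum>i\<in>I. f i x)"
  by (induction I rule: infinite_finite_induct) (auto intro!: class_C_add)

lemma class_C_componentwise:
  assumes "\<And>b. b \<in> Basis \<Longrightarrow> class_C k (\<lambda>x. f x \<bullet> b)"
  shows "class_C k f"
proof -
  have "class_C k (\<lambda>x. \<Sum>b\<in>Basis. (f x \<bullet> b) *\<^sub>R b)"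
    by (intro class_C_sum class_C_scaleR assms class_C_const)
  then show ?thesis by (simp add: euclidean_representation)
qed

lemma class_C_nth: "class_C k f \<Longrightarrow> class_C k (\<lambda>x. f x $ i)"
  for f :: "'a::euclidean_space \<Rightarrow> real ^ 'n"
  using class_C_inner[OF _ class_C_const[of k "axis i 1"], of f] by (simp add: inner_axis)

lemma class_C_vecI:
  fixes f :: "'a::euclidean_space \<Rightarrow> real ^ 'n"
  assumes "\<And>i. class_C k (\<lambda>x. f x $ i)"
  shows "class_C k f"
  by (rule class_C_componentwise) (use assms in \<open>auto simp: Basis_vec_def inner_axis\<close>)

lemma class_C_compose:
  "class_C k g \<Longrightarrow> class_C k f \<Longrightarrow> class_C k (\<lambda>x. g (f x))"
proof (induction k arbitrary: f g)
  case 0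
  then show ?case using continuous_on_compose2[of UNIV g UNIV f] by simp
next
  case (Suc k)
  let ?g = "\<lambda>y. frechet_derivative g (at y)" and ?f = "\<lambda>x. frechet_derivative f (at x)"
  have lin: "linear (?g y)" for y
    using Suc.prems(1) by (simp add: linear_frechet_derivative)
  have "class_C k (\<lambda>x. ?g (f x) (?f x v))" for v
  proof -
    \<comment> \<open>Both the base point and the direction of \<open>?g\<close> vary with
      \<open>x\<close>. Expanding the direction in the basis leaves fixed directions only, to which
      the induction hypothesis applies.\<close>
    have "?g (f x) (?f x v) = (\<Sum>b\<in>Basis. (?f x v \<bullet> b) *\<^sub>R ?g (f x) b)" for x
      using linear_sum[OF lin, of "f x" "\<lambda>b. (?f x v \<bullet> b) *\<^sub>R b" Basis]
      by (simp add: euclidean_representation linear_cmul[OF lin])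
    moreover have "class_C k (\<lambda>x. \<Sum>b\<in>Basis. (?f x v \<bullet> b) *\<^sub>R ?g (f x) b)"
      using Suc.prems
      by (intro class_C_sum class_C_scaleR class_C_inner class_C_const Suc.IH
          class_C_SucD[OF Suc.prems(2)]) auto
    ultimately show ?thesis by simp
  qed
  then show ?case
    by (intro class_C_SucI[OF has_derivative_compose[OF
          Suc.prems(2)[THEN class_C_Suc_has_derivative] Suc.prems(1)[THEN class_C_Suc_has_derivative]]])
qed

lemma class_C_inverse:
  fixes f :: "'a::euclidean_space \<Rightarrow> real"
  assumes "\<And>x. f x \<noteq> 0"
  shows "class_C k f \<Longrightarrow> class_C k (\<lambda>x. inverse (f x))"
proof (induction k)
  case 0
  then show ?case using assms by (auto intro: continuous_on_inverse)
next
  case (Suc k)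
  note inv = Suc.IH[OF class_C_SucD[OF Suc.prems]]
  show ?case
    by (rule class_C_SucI[OF Deriv.has_derivative_inverse[OF assms Suc.prems[THEN class_C_Suc_has_derivative]]])
       (use Suc.prems in \<open>auto intro!: class_C_minus class_C_mult inv\<close>)
qed

lemma class_C_divide:
  fixes f g :: "'a::euclidean_space \<Rightarrow> real"
  assumes "class_C k f" "class_C k g" "\<And>x. g x \<noteq> 0"
  shows "class_C k (\<lambda>x. f x / g x)"
  unfolding divide_inverse by (intro class_C_mult class_C_inverse assms)

text \<open>The derivative is expressed through the square root itself and the derivative of
  \<open>f\<close>, so each order of regularity yields the next; positivity keeps the root away from
  its singularity.\<close>

lemma class_C_sqrt:
  fixes f :: "'a::euclidean_space \<Rightarrow> real"
  assumes pos: "\<And>x. f x > 0"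
  shows "class_C k f \<Longrightarrow> class_C k (\<lambda>x. sqrt (f x))"
proof (induction k)
  case 0
  then show ?case by (auto intro: continuous_on_real_sqrt)
next
  case (Suc k)
  note sq = Suc.IH[OF class_C_SucD[OF Suc.prems]]
  have "sqrt (f x) \<noteq> 0" for x using pos[of x] by simp
  then have "class_C k (\<lambda>x. inverse (sqrt (f x)) / 2 * frechet_derivative f (at x) v)" for v
    using Suc.prems by (intro class_C_mult class_C_divide class_C_inverse sq class_C_const) auto
  moreover have "((\<lambda>x. sqrt (f x)) has_derivative
      (\<lambda>v. inverse (sqrt (f x)) / 2 * frechet_derivative f (at x) v)) (at x)" for x
    using DERIV_compose_FDERIV[OF DERIV_real_sqrt[OF pos] Suc.prems[THEN class_C_Suc_has_derivative], of x]
    by (simp add: mult.commute)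
  ultimately show ?case by (intro class_C_SucI)
qed

text \<open>Bootstrapping: the derivative of \<open>inv f\<close> is \<open>g'\<close> evaluated
  along \<open>inv f\<close>, so \<open>inv f\<close> of class k has a derivative of class k.
  Supplying the inverse derivative as an explicit \<open>g'\<close> reduces its smoothness to that
  of a formula.\<close>

lemma smooth_inv:
  fixes f :: "'a::euclidean_space \<Rightarrow> 'b::euclidean_space"
  assumes bij: "bij f" and cont: "continuous_on UNIV (inv f)"
    and der: "\<And>x. (f has_derivative f' x) (at x)"
    and lin: "\<And>x. linear (g' x)" and inv: "\<And>x v. g' x (f' x v) = v"
    and sm: "\<And>v. smooth (\<lambda>x. g' x v)"
  shows "smooth (inv f)" "(inv f has_derivative g' (inv f y)) (at y)"
proof -
  have f_inv: "f (inv f y) = y" for y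
    using bij by (simp add: bij_is_surj surj_f_inv_f)
  show der': "(inv f has_derivative g' (inv f y)) (at y)" for y
  proof (rule has_derivative_inverse_basic[where T = UNIV and f = f])
    show "(f has_derivative f' (inv f y)) (at (inv f y))" by (rule der)
    show "continuous (at y) (inv f)"
      using cont by (simp add: continuous_on_eq_continuous_at)
  qed (use lin inv f_inv in \<open>auto simp: linear_conv_bounded_linear\<close>)
  show "smooth (inv f)"
    unfolding smooth_def
  proof
    show "class_C k (inv f)" for k
    proof (induction k)
      case 0
      then show ?case using cont by simp
    next
      case (Suc k)
      then show ?case
        using sm class_C_compose[of k _ "inv f"] by (intro class_C_SucI[OF der']) (auto simp: smooth_def)
    qed
  qed
qed

lemma has_derivative_vecI:
  fixes f :: "'a::real_normed_vector \<Rightarrow> real ^ 'n"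
  assumes "\<And>i. ((\<lambda>x. f x $ i) has_derivative (\<lambda>v. f' v $ i)) (at x)"
  shows "(f has_derivative f') (at x)"
  by (subst has_derivative_componentwise_within)
     (use assms in \<open>auto simp: Basis_vec_def inner_axis\<close>)

lemma has_derivative_nth:
  "(f has_derivative f') (at x) \<Longrightarrow> ((\<lambda>x. f x $ i) has_derivative (\<lambda>v. f' v $ i)) (at x)"
  for f :: "'a::real_normed_vector \<Rightarrow> real ^ 'n"
  by (rule bounded_linear.has_derivative[OF bounded_linear_vec_nth])

section \<open>Symmetry of second derivatives and closed forms\<close>

text \<open>The second difference of \<open>f\<close> is symmetric in \<open>v\<close> and
  \<open>w\<close>. Two applications of the mean value theorem, first along \<open>v\<close> and
  then along \<open>w\<close>, show that its quotient tends to one mixed derivative; exchanging the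
  directions gives the other.\<close>

lemma frechet_derivative_symmetric_real:
  fixes f :: "'a::euclidean_space \<Rightarrow> real"
  assumes C2: "class_C 2 f"
  defines "D \<equiv> \<lambda>v g x. frechet_derivative g (at x) v"
  shows "D w (D v f) x = D v (D w f) x"
proof -
  have C1: "class_C 1 (D v f)" for v
    using C2 by (simp add: D_def numeral_2_eq_2)
  have C0: "continuous_on UNIV (D w (D v f))" for v w
    using C1[of v] by (simp add: D_def)
  have f_d: "(f has_derivative (\<lambda>v. D v f x)) (at x)" for x
    using class_C_Suc_has_derivative[of 1 f x] C2 by (simp add: D_def numeral_2_eq_2)
  have Df_d: "(D v f has_derivative (\<lambda>w. D w (D v f) x)) (at x)" for v x
    using class_C_Suc_has_derivative[of 0 "D v f" x] C1[of v] by (simp add: D_def)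
  have line: "((\<lambda>s. h (y + s *\<^sub>R u)) has_real_derivative D u h (y + s *\<^sub>R u)) (at s)"
    if "\<And>x. (h has_derivative (\<lambda>v. D v h x)) (at x)" for h y u s
  proof -
    have "((\<lambda>s. h (y + s *\<^sub>R u)) has_derivative (\<lambda>t. D (t *\<^sub>R u) h (y + s *\<^sub>R u))) (at s)"
      by (rule has_derivative_compose[OF _ that]) (auto intro!: derivative_eq_intros)
    moreover have "D (t *\<^sub>R u) h (y + s *\<^sub>R u) = t * D u h (y + s *\<^sub>R u)" for t
      using linear_cmul[OF has_derivative_linear[OF that]] by simp
    ultimately show ?thesis
      by (simp add: has_field_derivative_def mult_commute_abs)
  qed
  have key: "\<exists>z. norm (z - x) \<le> e * (norm v + norm w) \<and>
      f (x + e *\<^sub>R v + e *\<^sub>R w) - f (x + e *\<^sub>R v) - f (x + e *\<^sub>R w) + f x = e\<^sup>2 * D w (D v f) z"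
    if e: "e > 0" for e v w
  proof -
    let ?h = "\<lambda>s. f ((x + e *\<^sub>R w) + s *\<^sub>R v) - f (x + s *\<^sub>R v)"
    obtain s where s: "0 < s" "s < e"
      "?h e - ?h 0 = (e - 0) * (D v f ((x + e *\<^sub>R w) + s *\<^sub>R v) - D v f (x + s *\<^sub>R v))"
      using MVT2[OF e, of ?h, OF DERIV_diff[OF line[OF f_d] line[OF f_d]]] by blast
    obtain t where t: "0 < t" "t < e"
      "D v f ((x + s *\<^sub>R v) + e *\<^sub>R w) - D v f ((x + s *\<^sub>R v) + 0 *\<^sub>R w)
        = (e - 0) * D w (D v f) ((x + s *\<^sub>R v) + t *\<^sub>R w)"
      using MVT2[OF e, of "\<lambda>t. D v f ((x + s *\<^sub>R v) + t *\<^sub>R w)", OF line[OF Df_d]] by blast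
    have "norm (s *\<^sub>R v + t *\<^sub>R w) \<le> s * norm v + t * norm w"
      using norm_triangle_ineq[of "s *\<^sub>R v" "t *\<^sub>R w"] s t by simp
    also have "\<dots> \<le> e * norm v + e * norm w"
      using s t by (intro add_mono mult_right_mono) auto
    finally have "norm ((x + s *\<^sub>R v) + t *\<^sub>R w - x) \<le> e * (norm v + norm w)"
      by (simp add: algebra_simps)
    then show ?thesis
      using s(3) t(3) by (intro exI[of _ "(x + s *\<^sub>R v) + t *\<^sub>R w"]) (simp add: algebra_simps power2_eq_square)
  qed
  have lim: "(\<lambda>n. (f (x + e n *\<^sub>R v + e n *\<^sub>R w) - f (x + e n *\<^sub>R v) - f (x + e n *\<^sub>R w) + f x) / (e n)\<^sup>2)
      \<longlonglongrightarrow> D w (D v f) x" if e_def: "e = (\<lambda>n. 1 / real (Suc n))" for v w e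
  proof -
    have pos: "e n > 0" for n by (simp add: e_def)
    have "\<forall>n. \<exists>z. norm (z - x) \<le> e n * (norm v + norm w) \<and>
      f (x + e n *\<^sub>R v + e n *\<^sub>R w) - f (x + e n *\<^sub>R v) - f (x + e n *\<^sub>R w) + f x = (e n)\<^sup>2 * D w (D v f) z"
      using key[OF pos] by blast
    from choice[OF this] obtain z where z: "\<And>n. norm (z n - x) \<le> e n * (norm v + norm w)"
      "\<And>n. f (x + e n *\<^sub>R v + e n *\<^sub>R w) - f (x + e n *\<^sub>R v) - f (x + e n *\<^sub>R w) + f x = (e n)\<^sup>2 * D w (D v f) (z n)"
      by blast
    have "(\<lambda>n. e n * (norm v + norm w)) \<longlonglongrightarrow> 0 * (norm v + norm w)"
      unfolding e_def by (intro tendsto_intros lim_1_over_n[THEN LIMSEQ_Suc])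
    then have "(\<lambda>n. z n - x) \<longlonglongrightarrow> 0"
      by (intro Lim_null_comparison[of "\<lambda>n. z n - x"]) (use z in auto)
    then have "z \<longlonglongrightarrow> x"
      by (simp add: LIM_zero_iff)
    then have "(\<lambda>n. D w (D v f) (z n)) \<longlonglongrightarrow> D w (D v f) x"
      using C0 by (auto intro: continuous_on_tendsto_compose[of UNIV])
    then show ?thesis
      using pos by (simp add: z(2) less_imp_neq[symmetric] less_imp_neq[THEN not_sym])
  qed
  show ?thesis
    by (rule LIMSEQ_unique[OF lim[OF refl, of v w]])
       (use lim[OF refl, of w v] in \<open>simp add: algebra_simps\<close>)
qed

text \<open>The mean value theorem on the segment from \<open>x\<close> to \<open>y\<close> bounds
  the error by the variation of \<open>f'\<close> on the finitely many basis vectors. This lets a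
  potential defined by an integral be differentiated along one line at a time.\<close>

lemma has_derivative_of_directional:
  fixes f :: "'a::euclidean_space \<Rightarrow> real"
  assumes lin: "\<And>x. linear (f' x)"
    and cont: "\<And>v. continuous_on UNIV (\<lambda>x. f' x v)"
    and dir: "\<And>x v. ((\<lambda>t. f (x + t *\<^sub>R v)) has_real_derivative f' x v) (at 0)"
  shows "(f has_derivative f' x) (at x)"
proof (rule has_derivativeI)
  show "bounded_linear (f' x)"
    using lin linear_conv_bounded_linear by blast
next
  let ?m = "\<lambda>y. \<Sum>b\<in>Basis. \<bar>f' y b - f' x b\<bar>"
  show "((\<lambda>y. (f y - f x - f' x (y - x)) /\<^sub>R norm (y - x)) \<longlongrightarrow> 0) (at x)"
  proof (rule tendstoI)
    fix e :: real assume e: "e > 0"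
    have "(?m \<longlongrightarrow> ?m x) (at x)"
      using cont by (intro tendsto_intros) (simp add: continuous_on_def)
    then have "eventually (\<lambda>y. ?m y < e) (at x)"
      using order_tendstoD(2)[of ?m 0 "at x" e] e by simp
    then obtain d where d: "d > 0" "\<And>y. y \<noteq> x \<Longrightarrow> dist y x < d \<Longrightarrow> ?m y < e"
      by (auto simp: eventually_at)
    have "dist ((f y - f x - f' x (y - x)) /\<^sub>R norm (y - x)) 0 < e" if y: "y \<noteq> x" "dist y x < d" for y
    proof -
      define h where "h = y - x"
      \<comment> \<open>The hypothesis \<open>dir\<close> differentiates at parameter 0 only; moving
        the base point along the line carries it to every \<open>s\<close>.\<close>
      have line: "((\<lambda>t. f (x + t *\<^sub>R h)) has_real_derivative f' (x + s *\<^sub>R h) h) (at s)" for s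
      proof -
        have "((\<lambda>t. f (x + s *\<^sub>R h + t *\<^sub>R h)) has_real_derivative f' (x + s *\<^sub>R h) h) (at (s - s))"
          using dir by simp
        then have "((\<lambda>t. f (x + s *\<^sub>R h + (t - s) *\<^sub>R h)) has_real_derivative f' (x + s *\<^sub>R h) h * (1 - 0)) (at s)"
          by (intro DERIV_chain2[where g = "\<lambda>t. t - s"]) (auto intro!: derivative_eq_intros)
        then show ?thesis by (simp add: algebra_simps)
      qed
      obtain s where s: "0 < s" "s < 1" "f (x + 1 *\<^sub>R h) - f (x + 0 *\<^sub>R h) = (1 - 0) * f' (x + s *\<^sub>R h) h"
        using MVT2[OF zero_less_one, of "\<lambda>t. f (x + t *\<^sub>R h)", OF line] by blast
      let ?z = "x + s *\<^sub>R h"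
      have "h \<noteq> 0" using y by (simp add: h_def)
      then have z: "?m ?z < e"
        using s y by (intro d(2)) (auto simp: dist_norm h_def intro: le_less_trans[rotated] mult_left_le_one_le)
      have "f' u h = (\<Sum>b\<in>Basis. (h \<bullet> b) * f' u b)" for u
        using linear_sum[OF lin, of u "\<lambda>b. (h \<bullet> b) *\<^sub>R b" Basis]
        by (simp add: euclidean_representation linear_cmul[OF lin])
      then have "\<bar>f' ?z h - f' x h\<bar> = \<bar>\<Sum>b\<in>Basis. (h \<bullet> b) * (f' ?z b - f' x b)\<bar>"
        by (simp add: sum_subtractf algebra_simps)
      also have "\<dots> \<le> (\<Sum>b\<in>Basis. \<bar>h \<bullet> b\<bar> * \<bar>f' ?z b - f' x b\<bar>)"
        using sum_abs[of "\<lambda>b. (h \<bullet> b) * (f' ?z b - f' x b)" Basis] by (simp add: abs_mult)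
      also have "\<dots> \<le> (\<Sum>b\<in>Basis. norm h * \<bar>f' ?z b - f' x b\<bar>)"
        by (intro sum_mono mult_right_mono Basis_le_norm) auto
      also have "\<dots> = norm h * ?m ?z"
        by (simp add: sum_distrib_left)
      also have "\<dots> < norm h * e"
        using z \<open>h \<noteq> 0\<close> by simp
      finally have "\<bar>f y - f x - f' x h\<bar> < norm h * e"
        using s(3) by (simp add: h_def)
      then show ?thesis
        using \<open>h \<noteq> 0\<close> by (simp add: h_def[symmetric] field_simps abs_mult)
    qed
    then show "eventually (\<lambda>y. dist ((f y - f x - f' x (y - x)) /\<^sub>R norm (y - x)) 0 < e) (at x)"
      using d(1) by (auto simp: eventually_at)
  qed
qed

text \<open>The potential is the integral of the form along the segment from the origin.
  Differentiating under the integral and using closedness turns the integrand into the derivative of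
  \<open>t * \<omega> (t *\<^sub>R x) v\<close> in \<open>t\<close>, whose integral is the boundary
  value at \<open>t = 1\<close>.\<close>

lemma poincare_lemma:
  fixes \<omega> :: "'a::euclidean_space \<Rightarrow> 'a \<Rightarrow> real"
  assumes lin: "\<And>x. linear (\<omega> x)"
    and C1: "\<And>v. class_C 1 (\<lambda>x. \<omega> x v)"
    and closed: "\<And>x v w. frechet_derivative (\<lambda>y. \<omega> y v) (at x) w = frechet_derivative (\<lambda>y. \<omega> y w) (at x) v"
  shows "\<exists>f. \<forall>x. (f has_derivative \<omega> x) (at x)"
proof (intro exI allI)
  let ?D = "\<lambda>x v w. frechet_derivative (\<lambda>y. \<omega> y v) (at x) w"
  have cont: "continuous_on S (\<lambda>x. \<omega> x v)" and contD: "continuous_on S (\<lambda>x. ?D x v w)" for v w S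
    using C1[of v] class_C_imp_continuous[OF C1] by (auto intro: continuous_on_subset)
  note [continuous_intros] = continuous_on_compose2[OF cont _ subset_UNIV] continuous_on_compose2[OF contD _ subset_UNIV]
  have der: "((\<lambda>y. \<omega> y v) has_derivative ?D x v) (at x)" for x v
    using class_C_Suc_has_derivative[of 0] C1[of v] by simp
  have chain: "((\<lambda>s. \<omega> (c s) v) has_real_derivative ?D (c s) v c') (at s within S)"
    if "(c has_vector_derivative c') (at s within S)" for c c' s v S
  proof -
    have "((\<lambda>s. \<omega> (c s) v) has_derivative (\<lambda>t. ?D (c s) v (t *\<^sub>R c'))) (at s within S)"
      using has_derivative_compose[OF that[unfolded has_vector_derivative_def] der] .
    moreover have "?D (c s) v (t *\<^sub>R c') = t * ?D (c s) v c'" for t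
      using linear_cmul[OF has_derivative_linear[OF der]] by simp
    ultimately show ?thesis
      by (simp add: has_field_derivative_def mult_commute_abs)
  qed
  let ?f = "\<lambda>x. integral (cbox 0 1) (\<lambda>t. \<omega> (t *\<^sub>R x) x)"
  show "(?f has_derivative \<omega> x) (at x)" for x
  proof (rule has_derivative_of_directional[OF lin cont])
    fix x v
    \<comment> \<open>Linearity splits the form's value on \<open>x + s *\<^sub>R v\<close>, so that
      \<open>s\<close> enters only through the base point and one explicit factor;
      \<open>?g'\<close> is then the product rule.\<close>
    let ?g = "\<lambda>s t. \<omega> (t *\<^sub>R (x + s *\<^sub>R v)) x + s * \<omega> (t *\<^sub>R (x + s *\<^sub>R v)) v"
    let ?g' = "\<lambda>s t. ?D (t *\<^sub>R (x + s *\<^sub>R v)) x (t *\<^sub>R v)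
      + (\<omega> (t *\<^sub>R (x + s *\<^sub>R v)) v + s * ?D (t *\<^sub>R (x + s *\<^sub>R v)) v (t *\<^sub>R v))"
    have D_scale: "?D y u (t *\<^sub>R v) = t * ?D y u v" for y u t v
      using linear_cmul[OF has_derivative_linear[OF der]] by simp
    have "((\<lambda>s. integral (cbox 0 1) (?g s)) has_vector_derivative integral (cbox 0 1) (?g' 0)) (at 0 within UNIV)"
    proof (rule leibniz_rule_vector_derivative)
      have c: "((\<lambda>s. t *\<^sub>R (x + s *\<^sub>R v)) has_vector_derivative t *\<^sub>R v) (at s)" for s t
        by (auto intro!: derivative_eq_intros)
      show "((\<lambda>s. ?g s t) has_vector_derivative ?g' s t) (at s within UNIV)" for s t
        unfolding has_real_derivative_iff_has_vector_derivative[symmetric]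
        by (rule DERIV_cong[OF DERIV_add[OF chain[OF c] DERIV_mult[OF DERIV_ident chain[OF c]]]]) simp
      show "?g s integrable_on cbox 0 1" for s
        by (intro integrable_continuous continuous_intros)
      show "continuous_on (UNIV \<times> cbox 0 1) (\<lambda>(s, t). ?g' s t)"
        unfolding D_scale split_beta by (intro continuous_intros)
    qed auto
    moreover have "integral (cbox 0 1) (?g s) = ?f (x + s *\<^sub>R v)" for s
      by (simp add: linear_add[OF lin] linear_cmul[OF lin])
    moreover have "integral (cbox 0 1) (?g' 0) = \<omega> x v"
    proof -
      have c: "((\<lambda>t. t *\<^sub>R x) has_vector_derivative x) (at t within S)" for t S
        by (auto intro!: derivative_eq_intros)
      have "((\<lambda>t. t * \<omega> (t *\<^sub>R x) v) has_real_derivative \<omega> (t *\<^sub>R x) v + t * ?D (t *\<^sub>R x) v x) (at t within S)" for t S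
        by (rule DERIV_cong[OF DERIV_mult[OF DERIV_ident chain[OF c]]]) simp
      then have "((\<lambda>t. \<omega> (t *\<^sub>R x) v + t * ?D (t *\<^sub>R x) v x) has_integral 1 * \<omega> (1 *\<^sub>R x) v - 0 * \<omega> (0 *\<^sub>R x) v) {0..1}"
        by (intro fundamental_theorem_of_calculus) (auto simp: has_real_derivative_iff_has_vector_derivative)
      then show ?thesis
        by (simp add: D_scale closed[of x _ v] integral_unique add.commute)
    qed
    ultimately show "((\<lambda>t. ?f (x + t *\<^sub>R v)) has_real_derivative \<omega> x v) (at 0)"
      by (simp add: has_real_derivative_iff_has_vector_derivative)
  qed
qed

section \<open>Coordinate partial derivatives and conjugate functions on the plane\<close>

lemma smooth_partial: "smooth f \<Longrightarrow> smooth (partial i f)"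
  unfolding smooth_def
proof
  fix k assume "\<forall>k. class_C k f"
  then have "class_C (Suc k) f" ..
  then have "class_C k (\<lambda>p. frechet_derivative f (at p) (axis i 1))" by simp
  then show "class_C k (partial i f)" by (simp add: partial_def[abs_def])
qed

lemma smooth_has_derivative: "smooth f \<Longrightarrow> (f has_derivative frechet_derivative f (at x)) (at x)"
  unfolding smooth_def using class_C_Suc_has_derivative by blast

lemma partial_eqI: "(f has_derivative f') (at p) \<Longrightarrow> partial i f p = f' (axis i 1)"
  unfolding partial_def by (metis frechet_derivative_at)

lemma partial_commute:
  fixes f :: "real ^ 'n \<Rightarrow> 'b::euclidean_space"
  assumes "class_C 2 f"
  shows "partial i (partial j f) p = partial j (partial i f) p"
proof (rule euclidean_eqI)
  fix b :: 'b assume "b \<in> Basis"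
  have C1: "class_C 1 (partial i f)" for i
    using assms by (simp add: numeral_2_eq_2 partial_def[abs_def])
  have inner: "partial i (\<lambda>x. g x \<bullet> b) p = partial i g p \<bullet> b"
    if "class_C (Suc 0) g" for g :: "real ^ 'n \<Rightarrow> 'b" and i p
    using partial_eqI[OF has_derivative_inner_left[OF class_C_Suc_has_derivative[OF that]]]
    by (simp add: partial_def)
  have fb: "class_C 2 (\<lambda>x. f x \<bullet> b)"
    by (intro class_C_inner assms class_C_const)
  have "class_C (Suc 0) f"
    using class_C_SucD assms by (simp add: numeral_2_eq_2 del: class_C.simps)
  then have "partial i (partial j f) p \<bullet> b = partial i (partial j (\<lambda>x. f x \<bullet> b)) p" for i j
  proof -
    have "partial j (\<lambda>x. f x \<bullet> b) = (\<lambda>p. partial j f p \<bullet> b)"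
      using inner[OF \<open>class_C (Suc 0) f\<close>] by (intro ext)
    then show ?thesis using inner C1 by (simp del: class_C.simps)
  qed
  then show "partial i (partial j f) p \<bullet> b = partial j (partial i f) p \<bullet> b"
    using frechet_derivative_symmetric_real[OF fb] by (simp add: partial_def[abs_def])
qed

lemma frechet_derivative_real2:
  fixes f :: "real ^ 2 \<Rightarrow> 'b::real_normed_vector"
  assumes "(f has_derivative f') (at p)"
  shows "f' v = v $ 1 *\<^sub>R partial 1 f p + v $ 2 *\<^sub>R partial 2 f p"
proof -
  have "v = v $ 1 *\<^sub>R axis 1 1 + v $ 2 *\<^sub>R axis 2 1"
    by (simp add: vec_eq_iff forall_2 axis_def)
  then have "f' v = f' (v $ 1 *\<^sub>R axis 1 1 + v $ 2 *\<^sub>R axis 2 1)" by simp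
  then show ?thesis
    by (simp add: linear_add linear_cmul has_derivative_linear[OF assms] partial_eqI[OF assms])
qed

text \<open>The one-form \<open>f dx2 - g dx1\<close> is closed precisely when the field
  \<open>(f, g)\<close> is divergence free.\<close>

lemma divergence_free_imp_conjugate:
  fixes f g :: "real ^ 2 \<Rightarrow> real"
  assumes f: "smooth f" and g: "smooth g"
    and div: "\<And>p. partial 1 f p + partial 2 g p = 0"
  shows "\<exists>h. \<forall>p. (h has_derivative (\<lambda>v. v $ 2 * f p - v $ 1 * g p)) (at p)"
proof (rule poincare_lemma)
  show "linear (\<lambda>v. v $ 2 * f p - v $ 1 * g p)" for p
    by (intro linearI) (simp_all add: algebra_simps)
  show "class_C 1 (\<lambda>p. v $ 2 * f p - v $ 1 * g p)" for v
    using f g by (intro class_C_diff class_C_mult class_C_const) (simp_all add: smooth_def)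
  fix p v w :: "real ^ 2"
  have D: "frechet_derivative (\<lambda>p. v $ 2 * f p - v $ 1 * g p) (at p) w
      = v $ 2 * frechet_derivative f (at p) w - v $ 1 * frechet_derivative g (at p) w" for v w :: "real ^ 2"
  proof -
    have "((\<lambda>p. v $ 2 * f p - v $ 1 * g p) has_derivative
      (\<lambda>w. v $ 2 * frechet_derivative f (at p) w - v $ 1 * frechet_derivative g (at p) w)) (at p)"
      by (intro derivative_intros smooth_has_derivative f g)
    from frechet_derivative_at[OF this, symmetric] show ?thesis by simp
  qed
  have "partial 2 g p = - partial 1 f p" using div[of p] by simp
  then show "frechet_derivative (\<lambda>p. v $ 2 * f p - v $ 1 * g p) (at p) w
      = frechet_derivative (\<lambda>p. w $ 2 * f p - w $ 1 * g p) (at p) v"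
    unfolding D
    by (simp add: frechet_derivative_real2[OF smooth_has_derivative[OF f]]
        frechet_derivative_real2[OF smooth_has_derivative[OF g]] algebra_simps)
qed

section \<open>A global inverse function theorem\<close>

text \<open>Upgrades continuity of the derivative in each fixed direction to continuity in operator
  norm.\<close>

lemma onorm_le_sum_Basis:
  fixes f :: "'a::euclidean_space \<Rightarrow> 'b::real_normed_vector"
  assumes "linear f"
  shows "onorm f \<le> (\<Sum>b\<in>Basis. norm (f b))"
proof (rule onorm_le)
  fix x
  have "f x = (\<Sum>b\<in>Basis. (x \<bullet> b) *\<^sub>R f b)"
    using linear_sum[OF assms, of "\<lambda>b. (x \<bullet> b) *\<^sub>R b" Basis]
    by (simp add: euclidean_representation linear_cmul[OF assms])
  also have "norm \<dots> \<le> (\<Sum>b\<in>Basis. norm x * norm (f b))"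
    by (rule sum_norm_le) (auto intro!: mult_right_mono Basis_le_norm)
  finally show "norm (f x) \<le> (\<Sum>b\<in>Basis. norm (f b)) * norm x"
    by (simp add: sum_distrib_left mult.commute)
qed

lemma C1_locally_injective:
  fixes f :: "'a::euclidean_space \<Rightarrow> 'b::euclidean_space"
  assumes der: "\<And>x. (f has_derivative f' x) (at x)"
    and cont: "\<And>v. continuous_on UNIV (\<lambda>x. f' x v)"
    and inj: "inj (f' a)"
  obtains r where "r > 0" "inj_on f (ball a r)"
proof -
  have lin: "linear (f' x)" for x
    using der has_derivative_linear by blast
  obtain g where g: "linear g" "g \<circ> f' a = id"
    using linear_injective_left_inverse[OF lin inj] by blast
  have onorm: "\<exists>d>0. \<forall>x. dist a x < d \<longrightarrow> onorm (\<lambda>v. f' x v - f' a v) < e" if "e > 0" for e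
  proof -
    let ?m = "\<lambda>x. \<Sum>b\<in>Basis. norm (f' x b - f' a b)"
    have "isCont ?m a"
      using cont by (intro continuous_intros) (simp add: continuous_on_eq_continuous_at)
    then have "\<forall>\<^sub>F x in at a. dist (?m x) (?m a) < e"
      unfolding isCont_def using \<open>e > 0\<close> by (rule tendstoD)
    then obtain d where d: "d > 0" "\<And>x. x \<noteq> a \<Longrightarrow> dist x a < d \<Longrightarrow> dist (?m x) (?m a) < e"
      unfolding eventually_at by blast
    have "onorm (\<lambda>v. f' x v - f' a v) < e" if "dist a x < d" for x
    proof (rule le_less_trans[OF onorm_le_sum_Basis[OF linear_compose_sub[OF lin lin]]])
      show "?m x < e"
        using d(2)[of x] that \<open>e > 0\<close> by (cases "x = a") (simp_all add: dist_commute dist_norm)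
    qed
    then show ?thesis using d(1) by blast
  qed
  show thesis
    by (rule has_derivative_locally_injective[of a UNIV g f' f])
       (use g der onorm that in \<open>auto simp: linear_conv_bounded_linear\<close>)
qed

text \<open>Otherwise there are pairs of distinct points with equal values whose distance to
  \<open>K\<close> tends to 0. Subsequences converge to points of \<open>K\<close> with equal
  values, which coincide by injectivity on \<open>K\<close>, and this contradicts local injectivity
  at the common limit.\<close>

lemma locally_injective_imp_injective_near_compact:
  fixes f :: "'a::euclidean_space \<Rightarrow> 'b::t2_space"
  assumes cont: "continuous_on UNIV f" and K: "compact K" and inj: "inj_on f K"
    and loc: "\<And>x. x \<in> K \<Longrightarrow> \<exists>r>0. inj_on f (ball x r)"
  obtains e where "e > 0" "inj_on f (\<Union>x\<in>K. ball x e)"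
proof (rule ccontr)
  assume "\<not> thesis"
  then have "\<not> inj_on f (\<Union>x\<in>K. ball x (1 / Suc n))" for n
    using that[of "1 / Suc n"] by auto
  then have "\<exists>p. fst p \<noteq> snd p \<and> f (fst p) = f (snd p) \<and> (\<exists>x\<in>K. dist x (fst p) < 1 / Suc n)
      \<and> (\<exists>x\<in>K. dist x (snd p) < 1 / Suc n)" for n
    unfolding inj_on_def by fastforce
  then obtain p where p: "\<And>n. fst (p n) \<noteq> snd (p n)" "\<And>n. f (fst (p n)) = f (snd (p n))"
    "\<And>n. \<exists>x\<in>K. dist x (fst (p n)) < 1 / Suc n" "\<And>n. \<exists>x\<in>K. dist x (snd (p n)) < 1 / Suc n"
    by metis
  obtain u v where u: "\<And>n. u n \<in> K" "\<And>n. dist (u n) (fst (p n)) < 1 / Suc n"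
    and v: "\<And>n. v n \<in> K" "\<And>n. dist (v n) (snd (p n)) < 1 / Suc n"
    using p(3,4) by metis
  obtain a b \<rho> where ab: "a \<in> K" "b \<in> K" and \<rho>: "strict_mono \<rho>" "((\<lambda>n. (u n, v n)) \<circ> \<rho>) \<longlonglongrightarrow> (a, b)"
  proof -
    have "\<forall>n. (u n, v n) \<in> K \<times> K" using u v by simp
    with compact_Times[OF K K] obtain l \<rho> where "l \<in> K \<times> K" "strict_mono \<rho>" "((\<lambda>n. (u n, v n)) \<circ> \<rho>) \<longlonglongrightarrow> l"
      unfolding compact_def by meson
    then show thesis using that by (cases l) auto
  qed
  have near: "(\<lambda>n. q (\<rho> n)) \<longlonglongrightarrow> c"
    if "\<And>n. dist (w n) (q n) < 1 / Suc n" "(\<lambda>n. w (\<rho> n)) \<longlonglongrightarrow> c" for w q :: "nat \<Rightarrow> 'a" and c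
  proof -
    have "(\<lambda>n. 1 / real (Suc (\<rho> n))) \<longlonglongrightarrow> 0"
      using LIMSEQ_subseq_LIMSEQ[OF LIMSEQ_Suc[OF lim_1_over_n] \<rho>(1)] by (simp add: o_def)
    then have "(\<lambda>n. q (\<rho> n) - w (\<rho> n)) \<longlonglongrightarrow> 0"
      by (rule Lim_null_comparison[rotated])
         (use that(1) in \<open>simp add: less_imp_le dist_norm norm_minus_commute\<close>)
    from tendsto_add[OF this that(2)] show ?thesis by simp
  qed
  have a: "(\<lambda>n. fst (p (\<rho> n))) \<longlonglongrightarrow> a" and b: "(\<lambda>n. snd (p (\<rho> n))) \<longlonglongrightarrow> b"
    using tendsto_fst[OF \<rho>(2)] tendsto_snd[OF \<rho>(2)] by (auto intro: near u v simp: o_def)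
  have "(\<lambda>n. f (fst (p (\<rho> n)))) \<longlonglongrightarrow> f a" "(\<lambda>n. f (snd (p (\<rho> n)))) \<longlonglongrightarrow> f b"
    using cont a b by (auto intro: continuous_on_tendsto_compose)
  then have "f a = f b"
    using LIMSEQ_unique p(2) by simp
  then have "a = b"
    using inj ab by (auto dest: inj_onD)
  obtain r where r: "r > 0" "inj_on f (ball a r)"
    using loc ab by blast
  have "\<forall>\<^sub>F n in sequentially. dist (fst (p (\<rho> n))) a < r \<and> dist (snd (p (\<rho> n))) a < r"
    using eventually_conj[OF tendstoD[OF a r(1)] tendstoD[OF b r(1)]] \<open>a = b\<close> by simp
  then obtain n where "dist (fst (p (\<rho> n))) a < r" "dist (snd (p (\<rho> n))) a < r"
    using eventually_sequentially by auto
  then show False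
    using inj_onD[OF r(2) p(2)[of "\<rho> n"]] p(1) by (simp add: dist_commute)
qed

text \<open>Uniqueness of lifts: the set of agreement is open because \<open>f\<close> is locally
  injective and closed because the target of the lifts is Hausdorff.\<close>

lemma sections_agree:
  fixes f :: "'a::t2_space \<Rightarrow> 'b::topological_space"
  assumes S: "connected S" and g: "continuous_on S g" and h: "continuous_on S h"
    and sec: "\<And>y. y \<in> S \<Longrightarrow> f (g y) = f (h y)"
    and loc: "\<And>x. \<exists>U. open U \<and> x \<in> U \<and> inj_on f U"
    and a: "a \<in> S" "g a = h a" and y: "y \<in> S"
  shows "g y = h y"
proof -
  let ?E = "{y \<in> S. g y = h y}"
  have "openin (top_of_set S) ?E"
  proof (subst openin_subopen, clarify)
    fix z assume z: "z \<in> S" "g z = h z"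
    obtain U where U: "open U" "g z \<in> U" "inj_on f U" using loc by blast
    let ?T = "(S \<inter> g -` U) \<inter> (S \<inter> h -` U)"
    have "openin (top_of_set S) ?T"
      using continuous_openin_preimage_gen[OF g U(1)] continuous_openin_preimage_gen[OF h U(1)]
      by (rule openin_Int)
    moreover have "?T \<subseteq> ?E"
      using U(3) sec by (auto dest: inj_onD)
    ultimately show "\<exists>T. openin (top_of_set S) T \<and> z \<in> T \<and> T \<subseteq> ?E"
      using z U(2) by (intro exI[of _ ?T]) auto
  qed
  moreover have "closedin (top_of_set S) ?E"
  proof -
    have "openin (top_of_set S) {y \<in> S. g y \<noteq> h y}"
    proof (subst openin_subopen, clarify)
      fix z assume z: "z \<in> S" "g z \<noteq> h z"
      then obtain U V where UV: "open U" "open V" "g z \<in> U" "h z \<in> V" "U \<inter> V = {}"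
        using hausdorff[of "g z" "h z"] by auto
      let ?T = "(S \<inter> g -` U) \<inter> (S \<inter> h -` V)"
      have "openin (top_of_set S) ?T"
        using continuous_openin_preimage_gen[OF g UV(1)] continuous_openin_preimage_gen[OF h UV(2)]
        by (rule openin_Int)
      moreover have "?T \<subseteq> {y \<in> S. g y \<noteq> h y}"
        using UV(5) by auto
      ultimately show "\<exists>T. openin (top_of_set S) T \<and> z \<in> T \<and> T \<subseteq> {y \<in> S. g y \<noteq> h y}"
        using z UV by (intro exI[of _ ?T]) auto
    qed
    moreover have "S - ?E = {y \<in> S. g y \<noteq> h y}" by auto
    ultimately show ?thesis by (simp add: closedin_def)
  qed
  ultimately have "?E = {} \<or> ?E = S"
    using S unfolding connected_clopen by blast
  then show ?thesis using a y by blast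
qed

text \<open>The range of a continuous section \<open>g\<close> is open by invariance of domain and
  closed as the fixed point set of \<open>g \<circ> f\<close>. Connectedness makes it the whole
  space, so \<open>g\<close> is a two-sided inverse.\<close>

lemma bij_if_sections:
  fixes f :: "'a::euclidean_space \<Rightarrow> 'a"
  assumes cont: "continuous_on UNIV f"
    and loc: "\<And>x. \<exists>r>0. inj_on f (ball x r)"
    and sec: "\<And>p. \<exists>g. continuous_on UNIV g \<and> g (f p) = p \<and> (\<forall>y. f (g y) = y)"
  shows "bij f" "continuous_on UNIV (inv f)"
proof -
  have loc': "\<exists>U. open U \<and> x \<in> U \<and> inj_on f U" for x
    using loc[of x] open_ball centre_in_ball by blast
  obtain g where g: "continuous_on UNIV g" "\<And>y. f (g y) = y"
    using sec by blast
  have "inj g" using g(2) by (metis injI)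
  then have "open (range g)"
    using invariance_of_domain[OF g(1) open_UNIV] by blast
  moreover have "closed (range g)"
  proof -
    have "x \<in> range g \<longleftrightarrow> g (f x) = x" for x
    proof
      assume "x \<in> range g"
      then obtain y where "x = g y" ..
      then show "g (f x) = x" by (simp only: g(2))
    next
      assume "g (f x) = x"
      then show "x \<in> range g" by (rule range_eqI[OF sym])
    qed
    then have "range g = {x. g (f x) = x}" by blast
    moreover have "closed {x. g (f x) = x}"
      by (rule closed_Collect_eq[OF continuous_on_compose2[OF g(1) cont subset_UNIV] continuous_on_id])
    ultimately show ?thesis by (simp only:)
  qed
  ultimately have "range g = UNIV"
    using clopen[of "range g"] by blast
  have gf: "g (f x) = x" for x
  proof -
    have "x \<in> range g" unfolding \<open>range g = UNIV\<close> by (rule UNIV_I)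
    then obtain y where "x = g y" ..
    then show ?thesis by (simp only: g(2))
  qed
  show "bij f" by (rule o_bij[of g]) (simp_all add: fun_eq_iff g(2) gf)
  have "inv f = g" by (rule inv_equality[OF gf g(2)])
  then show "continuous_on UNIV (inv f)" using g(1) by (simp only:)
qed

text \<open>For \<open>r \<le> 0\<close> the ball is empty and only \<open>g (f p) = p\<close>
  remains, hence the separate positivity conditions where sections are extended or glued.\<close>

definition section_on_ball :: "('a::metric_space \<Rightarrow> 'b::metric_space) \<Rightarrow> 'a \<Rightarrow> real \<Rightarrow> ('b \<Rightarrow> 'a) \<Rightarrow> bool" where
  "section_on_ball f p r g \<longleftrightarrow>
     continuous_on (ball (f p) r) g \<and> g (f p) = p \<and> (\<forall>y\<in>ball (f p) r. f (g y) = y)"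


lemma section_on_ball_of_inj:
  fixes f :: "'a::euclidean_space \<Rightarrow> 'a"
  assumes "continuous_on UNIV f" "open U" "inj_on f U" "p \<in> U" "ball (f p) r \<subseteq> f ` U"
  shows "section_on_ball f p r (inv_into U f)"
proof -
  have "continuous_on (f ` U) (inv_into U f)"
    by (rule continuous_on_inverse_open)
       (use assms continuous_on_subset[OF assms(1)] in auto)
  then show ?thesis
    using assms by (auto simp: section_on_ball_def f_inv_into_f intro: continuous_on_subset)
qed

text \<open>Concentric balls meet in convex sets containing the centre, where all sections take the
  value \<open>p\<close>; uniqueness of lifts makes them compatible. It serves both at a supremum of
  radii and for all radii at once.\<close>

lemma sections_on_balls_glue:
  fixes f :: "'a::euclidean_space \<Rightarrow> 'a"
  assumes loc: "\<And>x. \<exists>r>0. inj_on f (ball x r)"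
    and sec: "\<And>r. r \<in> I \<Longrightarrow> r > 0 \<and> (\<exists>g. section_on_ball f p r g)" and "I \<noteq> {}"
  obtains h where "continuous_on (\<Union>r\<in>I. ball (f p) r) h" "h (f p) = p"
    "\<And>y. y \<in> (\<Union>r\<in>I. ball (f p) r) \<Longrightarrow> f (h y) = y"
proof -
  have loc': "\<exists>U. open U \<and> x \<in> U \<and> inj_on f U" for x
    using loc[of x] open_ball centre_in_ball by blast
  obtain g where g: "\<And>r. r \<in> I \<Longrightarrow> section_on_ball f p r (g r)"
    using sec by metis
  have agree: "g r y = g s y" if "r \<in> I" "s \<in> I" "y \<in> ball (f p) r" "y \<in> ball (f p) s" for r s y
  proof (rule sections_agree[where f = f and g = "g r" and h = "g s" and y = y and S = "ball (f p) r \<inter> ball (f p) s" and a = "f p"])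
    show "connected (ball (f p) r \<inter> ball (f p) s)"
      by (intro convex_connected convex_Int convex_ball)
    show "continuous_on (ball (f p) r \<inter> ball (f p) s) (g r)"
      "continuous_on (ball (f p) r \<inter> ball (f p) s) (g s)"
      using g[OF that(1)] g[OF that(2)] by (auto simp: section_on_ball_def intro: continuous_on_subset)
    show "f (g r z) = f (g s z)" if "z \<in> ball (f p) r \<inter> ball (f p) s" for z
      using that g[OF \<open>r \<in> I\<close>] g[OF \<open>s \<in> I\<close>] by (simp add: section_on_ball_def)
    show "g r (f p) = g s (f p)"
      using g[OF that(1)] g[OF that(2)] by (simp add: section_on_ball_def)
    show "f p \<in> ball (f p) r \<inter> ball (f p) s"
      using sec[OF that(1)] sec[OF that(2)] by simp
  qed (use that loc' in simp_all)
  define \<rho> where "\<rho> y = (SOME r. r \<in> I \<and> y \<in> ball (f p) r)" for y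
  have \<rho>: "\<rho> y \<in> I \<and> y \<in> ball (f p) (\<rho> y)" if "r \<in> I" "y \<in> ball (f p) r" for r y
    unfolding \<rho>_def by (rule someI[of _ r]) (use that in simp)
  have h: "g (\<rho> y) y = g r y" if "r \<in> I" "y \<in> ball (f p) r" for r y
    using agree \<rho>[OF that] that by blast
  show thesis
  proof (rule that[of "\<lambda>y. g (\<rho> y) y"])
    show "continuous_on (\<Union>r\<in>I. ball (f p) r) (\<lambda>y. g (\<rho> y) y)"
    proof (rule continuous_on_open_UN)
      show "continuous_on (ball (f p) r) (\<lambda>y. g (\<rho> y) y)" if "r \<in> I" for r
        by (rule continuous_on_eq[where f = "g r"])
           (use g[OF that] h[OF that] in \<open>simp_all add: section_on_ball_def\<close>)
    qed auto
    show "g (\<rho> (f p)) (f p) = p"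
    proof -
      obtain r where r: "r \<in> I" using \<open>I \<noteq> {}\<close> by blast
      then show ?thesis using h[OF r, of "f p"] g[OF r] sec[OF r] by (simp add: section_on_ball_def)
    qed
    show "f (g (\<rho> y) y) = y" if "y \<in> (\<Union>r\<in>I. ball (f p) r)" for y
      using that g h by (auto simp: section_on_ball_def)
  qed
qed

text \<open>
  The metric pulled back by \<open>f\<close> is complete because \<open>\<phi>\<close> is proper and Lipschitz with respect to it.
\<close>

theorem hadamard_bij:
  fixes f :: "'a::euclidean_space \<Rightarrow> 'a" and \<phi> :: "'a \<Rightarrow> 'b::euclidean_space"
  assumes der: "\<And>x. (f has_derivative f' x) (at x)"
    and cont': "\<And>v. continuous_on UNIV (\<lambda>x. f' x v)"
    and inj: "\<And>x. inj (f' x)"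
    and der_\<phi>: "\<And>x. (\<phi> has_derivative \<phi>' x) (at x)"
    and bound: "\<And>x v. norm (\<phi>' x v) \<le> C * norm (f' x v)"
    and proper: "\<And>K. compact K \<Longrightarrow> compact (\<phi> -` K)"
  shows "bij f" "continuous_on UNIV (inv f)"
proof -
  have cont: "continuous_on UNIV f"
    using der has_derivative_continuous continuous_at_imp_continuous_on by blast
  have lin: "linear (f' x)" for x
    using der has_derivative_linear by blast
  have loc: "\<exists>r>0. inj_on f (ball x r)" for x
    using C1_locally_injective[OF der cont' inj] by metis
  have "\<exists>G. linear G \<and> (\<forall>v. f' x (G v) = v) \<and> (\<forall>v. G (f' x v) = v)" for x
    using linear_injective_isomorphism[OF lin inj] by metis
  then obtain G where G: "\<And>x. linear (G x)" "\<And>x v. f' x (G x v) = v" "\<And>x v. G x (f' x v) = v"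
    by metis
  \<comment> \<open>The continuation step, in two stages: a Lipschitz bound carries the section to
    the closed ball, and injectivity of \<open>f\<close> near the compact lift carries it past the
    boundary.\<close>
  have extend: "\<exists>s>r. \<exists>h. section_on_ball f p s h"
    if r: "r > 0" and "section_on_ball f p r g" for p r g
  proof -
    from that have g: "continuous_on (ball (f p) r) g" "g (f p) = p" "\<And>y. y \<in> ball (f p) r \<Longrightarrow> f (g y) = y"
      by (auto simp: section_on_ball_def)
    have der_g: "(g has_derivative G (g y)) (at y)" if "y \<in> ball (f p) r" for y
      by (rule has_derivative_inverse_basic[where T = "ball (f p) r" and f = f, OF der])
         (use g G that in \<open>auto simp: linear_conv_bounded_linear continuous_on_eq_continuous_at\<close>)
    \<comment> \<open>By the chain rule the derivative of \<open>\<phi> \<circ> g\<close> is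
      \<open>\<phi>'\<close> after the inverse of \<open>f'\<close>, and \<open>bound\<close> says
      exactly that this has norm at most \<open>C\<close>.\<close>
    have \<phi>g: "norm (\<phi> (g y) - \<phi> (g z)) \<le> C * norm (y - z)"
      if "y \<in> ball (f p) r" "z \<in> ball (f p) r" for y z
    proof (rule differentiable_bound[OF convex_ball _ _ that])
      show "((\<lambda>y. \<phi> (g y)) has_derivative (\<lambda>v. \<phi>' (g y) (G (g y) v))) (at y within ball (f p) r)"
        if "y \<in> ball (f p) r" for y
        by (rule has_derivative_compose[OF has_derivative_at_withinI[OF der_g[OF that]] der_\<phi>])
      show "onorm (\<lambda>v. \<phi>' (g y) (G (g y) v)) \<le> C" for y
        by (rule onorm_le) (use bound[of "g y" "G (g y) v" for v] G(2) in simp)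
    qed
    \<comment> \<open>Evaluating \<open>bound\<close> on the preimage of a unit vector under
      \<open>f' p\<close> leaves \<open>C\<close> on the right-hand side.\<close>
    have "C \<ge> 0"
    proof -
      obtain b :: 'a where "b \<in> Basis" using nonempty_Basis by blast
      then show ?thesis
        using bound[of p "G p b"] order_trans[OF norm_ge_zero, of "\<phi>' p (G p b)"] by (simp add: G(2))
    qed
    define K where "K = \<phi> -` cball (\<phi> p) (C * r)"
    have K: "compact K" unfolding K_def by (rule proper) simp
    have gK: "g y \<in> K" if "y \<in> ball (f p) r" for y
    proof -
      have "norm (\<phi> p - \<phi> (g y)) \<le> C * norm (f p - y)"
        using \<phi>g[OF _ that, of "f p"] r g(2) by simp
      also have "\<dots> \<le> C * r"
        using that \<open>C \<ge> 0\<close> by (intro mult_left_mono) (auto simp: dist_norm)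
      finally show ?thesis by (simp add: K_def dist_norm)
    qed
    \<comment> \<open>The minimum of \<open>norm (f' x v)\<close> over \<open>K\<close> and the unit
      sphere, positive by injectivity. Its reciprocal bounds the derivative of the lift, which stays
      inside \<open>K\<close>.\<close>
    obtain m where m: "m > 0" "\<And>x v. x \<in> K \<Longrightarrow> m * norm v \<le> norm (f' x v)"
    proof -
      let ?S = "K \<times> sphere (0::'a) 1"
      have ne: "?S \<noteq> {}"
        using gK[of "f p"] r by auto
      \<comment> \<open>Continuity is known for each fixed direction; the basis expansion makes it
        joint in point and direction.\<close>
      have eq: "f' x v = (\<Sum>b\<in>Basis. (v \<bullet> b) *\<^sub>R f' x b)" for x v
        using linear_sum[OF lin, of x "\<lambda>b. (v \<bullet> b) *\<^sub>R b" Basis]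
        by (simp add: euclidean_representation linear_cmul[OF lin])
      have "continuous_on ?S (\<lambda>z. norm (\<Sum>b\<in>Basis. (snd z \<bullet> b) *\<^sub>R f' (fst z) b))"
        by (intro continuous_intros continuous_on_compose2[OF cont']) auto
      then have "continuous_on ?S (\<lambda>z. norm (f' (fst z) (snd z)))"
        by (simp only: eq[symmetric])
      then obtain z where z: "z \<in> ?S" "\<And>w. w \<in> ?S \<Longrightarrow> norm (f' (fst z) (snd z)) \<le> norm (f' (fst w) (snd w))"
        using continuous_attains_inf[OF compact_Times[OF K compact_sphere] ne] by blast
      show thesis
      proof (rule that)
        have "f' (fst z) (snd z) \<noteq> f' (fst z) 0"
          using z(1) by (auto simp: inj_eq[OF inj])
        then show "norm (f' (fst z) (snd z)) > 0"
          using linear_0[OF lin] by simp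
        show "norm (f' (fst z) (snd z)) * norm v \<le> norm (f' x v)" if "x \<in> K" for x v
        proof (cases "v = 0")
          case False
          have "norm (f' (fst z) (snd z)) \<le> norm (f' x ((1 / norm v) *\<^sub>R v))"
            using z(2)[of "(x, (1 / norm v) *\<^sub>R v)"] that False by simp
          then show ?thesis
            using False by (simp add: linear_cmul[OF lin] field_simps)
        qed (simp add: linear_0[OF lin])
      qed
    qed
    have "(1 / m)-lipschitz_on (ball (f p) r) g"
    proof (rule bounded_derivative_imp_lipschitz[OF has_derivative_at_withinI[OF der_g]])
      show "onorm (G (g y)) \<le> 1 / m" if "y \<in> ball (f p) r" for y
      proof (rule onorm_le)
        show "norm (G (g y) v) \<le> 1 / m * norm v" for v
          using m(2)[OF gK[OF that], of "G (g y) v"] m(1) by (simp add: G(2) field_simps)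
      qed
    qed (use m in auto)
    then have "uniformly_continuous_on (ball (f p) r) g"
      by (rule lipschitz_on_uniformly_continuous)
    then obtain h where h: "uniformly_continuous_on (closure (ball (f p) r)) h"
        "\<And>y. y \<in> ball (f p) r \<Longrightarrow> g y = h y"
      using uniformly_continuous_on_extension_on_closure by metis
    have cont_h: "continuous_on (closure (ball (f p) r)) h"
      using h(1) uniformly_continuous_imp_continuous by blast
    have fh: "f (h y) = y" if "y \<in> cball (f p) r" for y
    proof -
      have "f (h y) - y = 0"
      proof (rule continuous_constant_on_closure[where S = "ball (f p) r" and f = "\<lambda>y. f (h y) - y" and x = y])
        show "continuous_on (closure (ball (f p) r)) (\<lambda>y. f (h y) - y)"
          by (intro continuous_intros continuous_on_compose2[OF cont cont_h]) auto
        show "f (h z) - z = 0" if "z \<in> ball (f p) r" for z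
          using g(3)[OF that] h(2)[OF that] by simp
        show "y \<in> closure (ball (f p) r)"
          using that r by simp
      qed
      then show ?thesis by simp
    qed
    \<comment> \<open>The lift of the closed ball is compact, and \<open>f\<close> is injective on
      it because \<open>h\<close> is inverse to \<open>f\<close> there.\<close>
    let ?K = "h ` cball (f p) r"
    have K': "compact ?K"
      using cont_h r by (auto simp: closure_ball intro: compact_continuous_image)
    have "inj_on f ?K"
      by (rule inj_on_inverseI[where g = h]) (auto simp: fh)
    from locally_injective_imp_injective_near_compact[OF cont K' this loc]
    obtain e where e: "e > 0" "inj_on f (\<Union>x\<in>?K. ball x e)" .
    let ?U = "\<Union>x\<in>?K. ball x e"
    have U: "open (f ` ?U)"
      using invariance_of_domain[OF continuous_on_subset[OF cont subset_UNIV] _ e(2)] by blast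
    have "cball (f p) r \<subseteq> f ` ?U"
    proof
      fix y assume y: "y \<in> cball (f p) r"
      have "h y \<in> ?U" using e(1) y by (intro UN_I[of "h y"]) auto
      then show "y \<in> f ` ?U" by (rule image_eqI[where f = f, OF fh[OF y, symmetric]])
    qed
    from compact_subset_open_imp_ball_epsilon_subset[OF compact_cball U this]
    obtain d where d: "d > 0" "(\<Union>y\<in>cball (f p) r. ball y d) \<subseteq> f ` ?U" .
    have "ball (f p) (r + d) \<subseteq> (\<Union>y\<in>cball (f p) r. ball y d)"
    proof
      fix y assume y: "y \<in> ball (f p) (r + d)"
      \<comment> \<open>Contracting \<open>y\<close> towards the centre by the factor
        \<open>r / (r + d)\<close> lands in the closed ball of radius \<open>r\<close> and moves
        \<open>y\<close> by less than \<open>d\<close>.\<close>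
      let ?z = "f p + (r / (r + d)) *\<^sub>R (y - f p)"
      have n: "norm (y - f p) < r + d"
        using y by (simp add: dist_norm norm_minus_commute)
      have "norm (y - f p) * (r / (r + d)) \<le> (r + d) * (r / (r + d))"
        using n r d by (intro mult_right_mono) auto
      then have "?z \<in> cball (f p) r"
        using r d by (simp add: dist_norm mult.commute)
      moreover have "y - ?z = (d / (r + d)) *\<^sub>R (y - f p)"
      proof -
        have "1 - r / (r + d) = d / (r + d)" using r d by (simp add: field_simps)
        moreover have "y - ?z = (1 - r / (r + d)) *\<^sub>R (y - f p)" by (simp add: algebra_simps)
        ultimately show ?thesis by metis
      qed
      moreover have "norm (y - f p) * (d / (r + d)) < (r + d) * (d / (r + d))"
        using n r d by (intro mult_strict_right_mono) auto
      ultimately have "dist y ?z < d"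
        using r d by (simp add: dist_norm mult.commute)
      then show "y \<in> (\<Union>y\<in>cball (f p) r. ball y d)"
        using \<open>?z \<in> cball (f p) r\<close> by (auto simp: dist_commute)
    qed
    moreover have "p \<in> ?U"
      using h(2)[of "f p"] g(2) r e(1) by (intro UN_I[of "h (f p)"]) auto
    ultimately have "section_on_ball f p (r + d) (inv_into ?U f)"
      using d(2) cont e by (intro section_on_ball_of_inj) auto
    then show ?thesis
      using d(1) by (intro exI[of _ "r + d"]) auto
  qed
  have sec: "\<exists>g. section_on_ball f p R g" if "R > 0" for p R
  proof (rule ccontr)
    assume no: "\<nexists>g. section_on_ball f p R g"
    \<comment> \<open>If \<open>R\<close> were out of reach it would bound the admissible radii.
      Gluing makes their supremum admissible, and \<open>extend\<close> then exceeds it.\<close>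
    let ?A = "{r. r > 0 \<and> (\<exists>g. section_on_ball f p r g)}"
    have le: "r \<le> R" if r: "r \<in> ?A" for r
    proof (rule ccontr)
      assume "\<not> r \<le> R"
      then have sub: "ball (f p) R \<subseteq> ball (f p) r" by (simp add: subset_ball)
      obtain g where "section_on_ball f p r g" using r by blast
      then have "section_on_ball f p R g"
        using continuous_on_subset[OF _ sub] sub by (auto simp: section_on_ball_def)
      then show False using no by blast
    qed
    obtain e where e: "e > 0" "inj_on f (ball p e)" using loc by blast
    have "open (f ` ball p e)"
      using invariance_of_domain[OF continuous_on_subset[OF cont subset_UNIV] _ e(2)] by blast
    moreover have "f p \<in> f ` ball p e" using e by simp
    ultimately obtain r where r: "r > 0" "ball (f p) r \<subseteq> f ` ball p e"
      using open_contains_ball by blast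
    have "section_on_ball f p r (inv_into (ball p e) f)"
      by (rule section_on_ball_of_inj[OF cont open_ball e(2) _ r(2)]) (use e(1) in simp)
    with r(1) have r_A: "r \<in> ?A" by blast
    have bdd: "bdd_above ?A" using le by (intro bdd_aboveI) auto
    have "(\<Union>r\<in>?A. ball (f p) r) = ball (f p) (Sup ?A)"
    proof (rule set_eqI)
      fix y
      have "?A \<noteq> {}" using r_A by blast
      then show "y \<in> (\<Union>r\<in>?A. ball (f p) r) \<longleftrightarrow> y \<in> ball (f p) (Sup ?A)"
        using less_cSup_iff[OF _ bdd, of "dist (f p) y"] by simp
    qed
    moreover obtain h where "continuous_on (\<Union>r\<in>?A. ball (f p) r) h" "h (f p) = p"
      "\<And>y. y \<in> (\<Union>r\<in>?A. ball (f p) r) \<Longrightarrow> f (h y) = y"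
    proof (rule sections_on_balls_glue[OF loc, of ?A p])
      show "?A \<noteq> {}" using r_A by blast
    qed auto
    ultimately have "section_on_ball f p (Sup ?A) h"
      by (simp add: section_on_ball_def)
    moreover have "Sup ?A > 0"
      using cSup_upper[OF r_A bdd] r by linarith
    ultimately obtain s where "s > Sup ?A" "s \<in> ?A"
      using extend by (smt (verit) mem_Collect_eq)
    then show False
      using cSup_upper[OF _ bdd] by (meson not_le)
  qed
  have "\<exists>g. continuous_on UNIV g \<and> g (f p) = p \<and> (\<forall>y. f (g y) = y)" for p
  proof -
    have "y \<in> (\<Union>r\<in>{0<..}. ball (f p) r)" for y
      by (rule UN_I[of "dist (f p) y + 1"]) (auto intro: add_nonneg_pos)
    then have "(\<Union>r\<in>{0<..}. ball (f p) r) = UNIV" by blast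
    moreover obtain h where "continuous_on (\<Union>r\<in>{0<..}. ball (f p) r) h" "h (f p) = p"
      "\<And>y. y \<in> (\<Union>r\<in>{0<..}. ball (f p) r) \<Longrightarrow> f (h y) = y"
      by (rule sections_on_balls_glue[OF loc, of "{0<..}" p]) (use sec gt_ex in auto)
    ultimately show ?thesis by auto
  qed
  from bij_if_sections[OF cont loc this] show "bij f" "continuous_on UNIV (inv f)" by blast+
qed

section \<open>The isothermal chart\<close>

text \<open>\<open>matrix_inv\<close> is a choice among two-sided inverses; a one-sided inverse of a
  square matrix is two-sided, and such an inverse is unique.\<close>

lemma matrix_inv_eqI:
  fixes A :: "'a::field ^ 'n ^ 'n"
  assumes "A ** B = mat 1"
  shows "matrix_inv A = B"
  unfolding matrix_inv_def
proof (rule some_equality)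
  show *: "A ** B = mat 1 \<and> B ** A = mat 1"
    using assms matrix_left_right_inverse by blast
  show "B' = B" if "A ** B' = mat 1 \<and> B' ** A = mat 1" for B'
    using that * by (metis matrix_mul_assoc matrix_mul_lid matrix_mul_rid)
qed

text \<open>The pointwise algebra behind the divergence form: the left-hand side of the conclusion
  is \<open>W\<close> times that of \<open>H\<close>. For one component, \<open>a\<close> and
  \<open>b\<close> are the first derivatives and \<open>p\<close>, \<open>q\<close>,
  \<open>r\<close> the second derivatives 11, 12, 22. A suffix \<open>a\<close> or \<open>b\<close>
  marks the Minkowski product of the full second derivative with the corresponding tangent vector,
  and \<open>t\<close> is the tangential part.\<close>

lemma divergence_identity:
  fixes E F G a b p q r pa pb qa qb ra rb W :: real
  defines "D \<equiv> F\<^sup>2 - E * G"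
  defines "t \<equiv> \<lambda>xa xb. (- G / D * xa + F / D * xb) * a + (F / D * xa - E / D * xb) * b"
  assumes D: "D \<noteq> 0" and W: "W\<^sup>2 = D"
    and H: "- G / D * (p - t pa pb) + F / D * (q - t qa qb) + F / D * (q - t qa qb) - E / D * (r - t ra rb) = 0"
  shows "(((pb + qa) * b + F * q - (2 * qb * a + G * p)) * W
        - (F * b - G * a) * ((2 * F * (pb + qa) - (2 * pa * G + E * (2 * qb))) / (2 * W))) / W\<^sup>2
      + (((qb + ra) * a + F * q - (2 * qa * b + E * r)) * W
        - (F * a - E * b) * ((2 * F * (qb + ra) - (2 * qa * G + E * (2 * rb))) / (2 * W))) / W\<^sup>2 = 0"
proof -
  have W0: "W \<noteq> 0" using D W by auto
  have frac: "(x * W - y * (w / (2 * W))) / W\<^sup>2 = (2 * x * W\<^sup>2 - y * w) / (2 * W ^ 3)" for x y w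
    using W0 by (simp add: field_simps power2_eq_square power3_eq_cube)
  have t: "D * t xa xb = (F * xb - G * xa) * a + (F * xa - E * xb) * b" for xa xb
    using D by (simp add: t_def field_simps)
  have "- G * (D * p - D * t pa pb) + 2 * F * (D * q - D * t qa qb) - E * (D * r - D * t ra rb)
      = D\<^sup>2 * (- G / D * (p - t pa pb) + F / D * (q - t qa qb) + F / D * (q - t qa qb) - E / D * (r - t ra rb))"
    using D by (simp add: field_simps power2_eq_square)
  also have "\<dots> = 0" by (simp only: H mult_zero_right)
  finally have key: "- G * (D * p - D * t pa pb) + 2 * F * (D * q - D * t qa qb) - E * (D * r - D * t ra rb) = 0" .
  let ?x1 = "(pb + qa) * b + F * q - (2 * qb * a + G * p)" and ?x2 = "(qb + ra) * a + F * q - (2 * qa * b + E * r)"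
  let ?w1 = "2 * F * (pb + qa) - (2 * pa * G + E * (2 * qb))" and ?w2 = "2 * F * (qb + ra) - (2 * qa * G + E * (2 * rb))"
  have "(2 * ?x1 * D - (F * b - G * a) * ?w1) + (2 * ?x2 * D - (F * a - E * b) * ?w2)
      = 2 * (- G * (D * p - D * t pa pb) + 2 * F * (D * q - D * t qa qb) - E * (D * r - D * t ra rb))"
    unfolding t by (simp add: D_def algebra_simps power2_eq_square)
  then have "(2 * ?x1 * W\<^sup>2 - (F * b - G * a) * ?w1) + (2 * ?x2 * W\<^sup>2 - (F * a - E * b) * ?w2) = 0"
    using key W by simp
  then show ?thesis
    unfolding frac add_divide_distrib[symmetric] by simp
qed

text \<open>
  The vectors \<open>P\<close> and \<open>Q\<close> are \<open>|det g|\<^bsup>1/2\<^esup> g\<^sup>i\<^sup>j \<partial>\<^sub>j \<phi>\<close> for \<open>i = 1, 2\<close>; \<open>u\<close> and \<open>v\<close> are the candidates for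
  \<open>\<phi>'\<^sub>s\<close> and \<open>\<phi>'\<^sub>t\<close>.
\<close>

lemma isothermal_frame:
  fixes a b :: "real ^ 3"
  defines "E \<equiv> minkowski a a" and "F \<equiv> minkowski a b" and "G \<equiv> minkowski b b"
  defines "W \<equiv> sqrt (F\<^sup>2 - E * G)"
  defines "P \<equiv> (1 / W) *\<^sub>R (F *\<^sub>R b - G *\<^sub>R a)" and "Q \<equiv> (1 / W) *\<^sub>R (F *\<^sub>R a - E *\<^sub>R b)"
  defines "J \<equiv> - (Q $ 1 * b $ 1 + P $ 1 * a $ 1)"
  defines "u \<equiv> (1 / J) *\<^sub>R (b $ 1 *\<^sub>R a - a $ 1 *\<^sub>R b)" and "v \<equiv> - (1 / J) *\<^sub>R (P $ 1 *\<^sub>R a + Q $ 1 *\<^sub>R b)"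
  assumes D: "F\<^sup>2 - E * G > 0"
  shows "J > 0" "u $ 1 = 0" "v $ 1 = 1"
    "u $ 2 * v $ 2 + u $ 3 * v $ 3 = 0"
    "(u $ 2)\<^sup>2 + (u $ 3)\<^sup>2 + (v $ 2)\<^sup>2 + (v $ 3)\<^sup>2 = 1"
    "v = - (1 / J) *\<^sub>R (a $ 1 *\<^sub>R P + b $ 1 *\<^sub>R Q)"
    "u = (1 / J) *\<^sub>R (P $ 1 *\<^sub>R Q - Q $ 1 *\<^sub>R P)"
proof -
  have W: "W > 0" "W\<^sup>2 = F\<^sup>2 - E * G" using D by (auto simp: W_def)
  \<comment> \<open>\<open>N\<close> is the squared Minkowski length of the tangent vector
    \<open>b $ 1 *\<^sub>R a - a $ 1 *\<^sub>R b\<close>, which has no time component and therefore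
    is spacelike or zero.\<close>
  define N where "N = (b $ 1 * a $ 2 - a $ 1 * b $ 2)\<^sup>2 + (b $ 1 * a $ 3 - a $ 1 * b $ 3)\<^sup>2"
  have N: "N = E * (b $ 1)\<^sup>2 - 2 * F * a $ 1 * b $ 1 + G * (a $ 1)\<^sup>2"
    by (simp add: N_def E_def F_def G_def minkowski_def power2_eq_square algebra_simps)
  have JN: "J = N / W"
    using W(1) by (simp add: J_def P_def Q_def N field_simps power2_eq_square)
  have "N \<noteq> 0"
  proof
    assume "N = 0"
    then have z: "b $ 1 * a $ 2 = a $ 1 * b $ 2" "b $ 1 * a $ 3 = a $ 1 * b $ 3"
      by (simp_all add: N_def sum_power2_eq_zero_iff)
    have "F\<^sup>2 - E * G \<le> 0"
    \<comment> \<open>Either both vectors are spatial, where Cauchy-Schwarz gives the sign, or they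
      are parallel and the discriminant vanishes.\<close>
    proof (cases "a $ 1 = 0 \<and> b $ 1 = 0")
      case True
      have "(a $ 2 * b $ 2 + a $ 3 * b $ 3)\<^sup>2 - (a $ 2 * a $ 2 + a $ 3 * a $ 3) * (b $ 2 * b $ 2 + b $ 3 * b $ 3)
        = - (a $ 2 * b $ 3 - a $ 3 * b $ 2)\<^sup>2" by (simp add: power2_eq_square algebra_simps)
      with True show ?thesis by (simp add: E_def F_def G_def minkowski_def)
    next
      case False
      then consider "a $ 1 \<noteq> 0" | "b $ 1 \<noteq> 0" by blast
      then show ?thesis
      proof cases
        case 1
        then have "b $ 2 = b $ 1 / a $ 1 * a $ 2" "b $ 3 = b $ 1 / a $ 1 * a $ 3" "b $ 1 = b $ 1 / a $ 1 * a $ 1"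
          using z by (simp_all add: field_simps)
        then obtain c where "b $ 1 = c * a $ 1" "b $ 2 = c * a $ 2" "b $ 3 = c * a $ 3" by blast
        then have "F = c * E" "G = c * F"
          unfolding E_def F_def G_def minkowski_def by (simp_all add: algebra_simps)
        then show ?thesis by (simp add: power2_eq_square)
      next
        case 2
        then have "a $ 2 = a $ 1 / b $ 1 * b $ 2" "a $ 3 = a $ 1 / b $ 1 * b $ 3" "a $ 1 = a $ 1 / b $ 1 * b $ 1"
          using z by (simp_all add: field_simps)
        then obtain c where "a $ 1 = c * b $ 1" "a $ 2 = c * b $ 2" "a $ 3 = c * b $ 3" by blast
        then have "F = c * G" "E = c * F"
          unfolding E_def F_def G_def minkowski_def by (simp_all add: algebra_simps)
        then show ?thesis by (simp add: power2_eq_square)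
      qed
    qed
    then show False using D by simp
  qed
  moreover have "N \<ge> 0" by (simp add: N_def)
  ultimately show J: "J > 0" using W(1) by (simp add: JN)
  show "u $ 1 = 0" by (simp add: u_def)
  show v1: "v $ 1 = 1" using J by (simp add: v_def) (simp add: J_def algebra_simps field_simps)
  \<comment> \<open>Together with \<open>vv\<close> and \<open>uv\<close>: in the frame
    \<open>u\<close>, \<open>v\<close> the form is diagonal with entries \<open>W / J\<close> and
    \<open>- W / J\<close>. Their sum is 0, and since the time components are 0 and 1 this is the
    normalisation to 1.\<close>
  have uu: "minkowski u u = W / J"
  proof -
    have "minkowski u u = (E * (b $ 1)\<^sup>2 - 2 * F * a $ 1 * b $ 1 + G * (a $ 1)\<^sup>2) / J\<^sup>2"
      using J by (simp add: u_def minkowski_def E_def F_def G_def field_simps power2_eq_square)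
    also have "\<dots> = W / J"
      using J W(1) unfolding N[symmetric] by (simp add: JN field_simps power2_eq_square)
    finally show ?thesis .
  qed
  have vE: "v = - (1 / (J * W)) *\<^sub>R ((F * b $ 1 - G * a $ 1) *\<^sub>R a + (F * a $ 1 - E * b $ 1) *\<^sub>R b)"
    using J W(1) by (simp add: v_def P_def Q_def vec_eq_iff field_simps)
  have vv: "minkowski v v = - W / J"
  proof -
    let ?c = "F * b $ 1 - G * a $ 1" and ?d = "F * a $ 1 - E * b $ 1"
    have "minkowski v v = (?c\<^sup>2 * E + 2 * ?c * ?d * F + ?d\<^sup>2 * G) / (J * W)\<^sup>2"
      unfolding vE using J W(1)
      by (simp add: minkowski_def E_def F_def G_def field_simps power2_eq_square)
    also have "?c\<^sup>2 * E + 2 * ?c * ?d * F + ?d\<^sup>2 * G = - (F\<^sup>2 - E * G) * N"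
      unfolding N by (simp add: power2_eq_square algebra_simps)
    also have "\<dots> / (J * W)\<^sup>2 = - W / J"
      using J W(1) unfolding W(2)[symmetric] by (simp add: JN field_simps power2_eq_square)
    finally show ?thesis .
  qed
  have uv: "minkowski u v = 0"
  proof -
    let ?c = "F * b $ 1 - G * a $ 1" and ?d = "F * a $ 1 - E * b $ 1"
    have "minkowski u v = - (b $ 1 * (?c * E + ?d * F) - a $ 1 * (?c * F + ?d * G)) / (J\<^sup>2 * W)"
      unfolding vE u_def using J W(1)
      by (simp add: minkowski_def E_def F_def G_def field_simps power2_eq_square)
    also have "b $ 1 * (?c * E + ?d * F) - a $ 1 * (?c * F + ?d * G) = 0"
      by (simp add: power2_eq_square algebra_simps)
    finally show ?thesis by simp
  qed
  show "u $ 2 * v $ 2 + u $ 3 * v $ 3 = 0"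
    using uv by (simp add: minkowski_def \<open>u $ 1 = 0\<close>)
  show "(u $ 2)\<^sup>2 + (u $ 3)\<^sup>2 + (v $ 2)\<^sup>2 + (v $ 3)\<^sup>2 = 1"
    using uu vv by (simp add: minkowski_def \<open>u $ 1 = 0\<close> v1 power2_eq_square)
  \<comment> \<open>Symmetry of the inverse metric allows the time component to be taken in either
    factor.\<close>
  show "v = - (1 / J) *\<^sub>R (a $ 1 *\<^sub>R P + b $ 1 *\<^sub>R Q)"
    using J W(1) by (simp add: v_def P_def Q_def vec_eq_iff field_simps)
  show "u = (1 / J) *\<^sub>R (P $ 1 *\<^sub>R Q - Q $ 1 *\<^sub>R P)"
  proof -
    \<comment> \<open>The coefficient matrix of \<open>P\<close>, \<open>Q\<close> with respect to
      \<open>a\<close>, \<open>b\<close> has determinant -1.\<close>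
    have "P $ 1 *\<^sub>R Q - Q $ 1 *\<^sub>R P = (1 / W\<^sup>2) *\<^sub>R ((F\<^sup>2 - E * G) *\<^sub>R (b $ 1 *\<^sub>R a - a $ 1 *\<^sub>R b))"
      using W(1) by (simp add: P_def Q_def vec_eq_iff field_simps power2_eq_square)
    also have "\<dots> = b $ 1 *\<^sub>R a - a $ 1 *\<^sub>R b"
      using W by (simp add: W(2)[symmetric])
    finally show ?thesis by (simp add: u_def)
  qed
qed

section \<open>The fields attached to a timelike minimal immersion\<close>

lemma bounded_bilinear_minkowski: "bounded_bilinear minkowski"
  unfolding bilinear_conv_bounded_bilinear[symmetric] bilinear_def
  by (auto intro!: linearI simp: minkowski_def algebra_simps)

lemmas class_C_intros = class_C_const class_C_add class_C_diff class_C_minus class_C_mult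
  class_C_scaleR class_C_nth class_C_bilinear[OF bounded_bilinear_minkowski]

locale timelike_minimal =
  fixes \<phi> :: "real ^ 2 \<Rightarrow> real ^ 3"
  assumes smooth: "smooth \<phi>" and timelike: "timelike \<phi>" and minimal: "vanishing_mean_curvature \<phi>"
begin

abbreviation a where "a \<equiv> partial 1 \<phi>"
abbreviation b where "b \<equiv> partial 2 \<phi>"

definition E where "E p = minkowski (a p) (a p)"
definition F where "F p = minkowski (a p) (b p)"
definition G where "G p = minkowski (b p) (b p)"
definition W where "W p = sqrt ((F p)\<^sup>2 - E p * G p)"
definition P where "P p = (1 / W p) *\<^sub>R (F p *\<^sub>R b p - G p *\<^sub>R a p)"
definition Q where "Q p = (1 / W p) *\<^sub>R (F p *\<^sub>R a p - E p *\<^sub>R b p)"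

lemma smooth_frame: "smooth a" "smooth b"
  by (intro smooth_partial smooth)+

lemma induced_form_nth:
  "induced_form \<phi> p $ 1 $ 1 = E p" "induced_form \<phi> p $ 1 $ 2 = F p"
  "induced_form \<phi> p $ 2 $ 1 = F p" "induced_form \<phi> p $ 2 $ 2 = G p"
  by (simp_all add: induced_form_def E_def F_def G_def minkowski_def algebra_simps)

lemma discriminant_pos: "(F p)\<^sup>2 - E p * G p > 0"
  using timelike unfolding timelike_def det_2 induced_form_nth by (simp add: power2_eq_square)

lemma W_pos: "W p > 0" and W_square: "(W p)\<^sup>2 = (F p)\<^sup>2 - E p * G p"
  using discriminant_pos[of p] by (simp_all add: W_def)

lemma class_C_coeffs: "class_C k a" "class_C k b" "class_C k E" "class_C k F" "class_C k G"
  using smooth_frame unfolding smooth_def E_def[abs_def] F_def[abs_def] G_def[abs_def]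
  by (auto intro!: class_C_intros)

lemma class_C_W: "class_C k W"
  unfolding W_def[abs_def] power2_eq_square
  using discriminant_pos by (intro class_C_sqrt class_C_intros class_C_coeffs) (simp add: power2_eq_square)

lemma class_C_PQ: "class_C k P" "class_C k Q"
  unfolding P_def[abs_def] Q_def[abs_def]
  using W_pos by (auto intro!: class_C_intros class_C_coeffs class_C_divide class_C_W simp: less_imp_neq[THEN not_sym])

text \<open>\<open>D\<close> is minus the determinant of the induced form, which flips the usual
  cofactor signs.\<close>

lemma matrix_inv_induced_form:
  defines "D \<equiv> \<lambda>p. (F p)\<^sup>2 - E p * G p"
  shows "matrix_inv (induced_form \<phi> p)
    = vector [vector [- G p / D p, F p / D p], vector [F p / D p, - E p / D p]]"
proof (rule matrix_inv_eqI)
  have "D p \<noteq> 0" using discriminant_pos[of p] by (simp add: D_def)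
  then show "induced_form \<phi> p ** vector [vector [- G p / D p, F p / D p], vector [F p / D p, - E p / D p]] = mat 1"
    by (simp add: vec_eq_iff forall_2 matrix_matrix_mult_def sum_2 mat_def induced_form_nth field_simps)
       (simp add: D_def power2_eq_square algebra_simps)
qed

lemma divergence_free: "partial 1 (\<lambda>p. P p $ i) p + partial 2 (\<lambda>p. Q p $ i) p = 0"
proof -
  let ?D = "(F p)\<^sup>2 - E p * G p"
  let ?da = "frechet_derivative a (at p)" and ?db = "frechet_derivative b (at p)"
  let ?dE = "\<lambda>v. 2 * minkowski (?da v) (a p)" and ?dG = "\<lambda>v. 2 * minkowski (?db v) (b p)"
  let ?dF = "\<lambda>v. minkowski (?da v) (b p) + minkowski (?db v) (a p)"
  let ?dW = "\<lambda>v. (2 * F p * ?dF v - (?dE v * G p + E p * ?dG v)) / (2 * W p)"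
  have da: "(a has_derivative ?da) (at p)" and db: "(b has_derivative ?db) (at p)"
    by (intro smooth_has_derivative smooth_frame)+
  note bil = bounded_bilinear.FDERIV[OF bounded_bilinear_minkowski]
  have comm: "minkowski x y = minkowski y x" for x y
    by (simp add: minkowski_def algebra_simps)
  have dE: "(E has_derivative ?dE) (at p)"
    unfolding E_def[abs_def] by (rule has_derivative_eq_rhs[OF bil[OF da da]]) (simp add: comm fun_eq_iff)
  have dF: "(F has_derivative ?dF) (at p)"
    unfolding F_def[abs_def]
    by (rule has_derivative_eq_rhs[OF bil[OF da db]]) (simp add: comm[of "a p"] fun_eq_iff)
  have dG: "(G has_derivative ?dG) (at p)"
    unfolding G_def[abs_def] by (rule has_derivative_eq_rhs[OF bil[OF db db]]) (simp add: comm fun_eq_iff)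
  have "((\<lambda>x. F x * F x - E x * G x) has_derivative
      (\<lambda>v. 2 * F p * ?dF v - (?dE v * G p + E p * ?dG v))) (at p)"
    by (rule has_derivative_eq_rhs[OF has_derivative_diff[OF has_derivative_mult[OF dF dF] has_derivative_mult[OF dE dG]]])
       (simp add: fun_eq_iff algebra_simps)
  then have dD: "((\<lambda>x. (F x)\<^sup>2 - E x * G x) has_derivative
      (\<lambda>v. 2 * F p * ?dF v - (?dE v * G p + E p * ?dG v))) (at p)"
    by (simp only: power2_eq_square)
  have dW: "(W has_derivative ?dW) (at p)"
    unfolding W_def[abs_def]
    by (rule has_derivative_eq_rhs[OF DERIV_compose_FDERIV[where g = "\<lambda>x. (F x)\<^sup>2 - E x * G x",
          OF DERIV_real_sqrt[OF discriminant_pos[of p]] dD]])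
       (simp add: fun_eq_iff field_simps)
  have dP: "((\<lambda>x. P x $ i) has_derivative (\<lambda>v. ((?dF v * b p $ i + F p * ?db v $ i - (?dG v * a p $ i + G p * ?da v $ i)) * W p
      - (F p * b p $ i - G p * a p $ i) * ?dW v) / (W p)\<^sup>2)) (at p)"
  proof -
    have "P x $ i = (F x * b x $ i - G x * a x $ i) / W x" for x by (simp add: P_def)
    then show ?thesis
      using has_derivative_divide'[OF has_derivative_diff[OF has_derivative_mult[OF dF has_derivative_nth[OF db, of i]]
          has_derivative_mult[OF dG has_derivative_nth[OF da, of i]]] dW] W_pos[of p]
      by (simp add: power2_eq_square add.commute)
  qed
  have dQ: "((\<lambda>x. Q x $ i) has_derivative (\<lambda>v. ((?dF v * a p $ i + F p * ?da v $ i - (?dE v * b p $ i + E p * ?db v $ i)) * W p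
      - (F p * a p $ i - E p * b p $ i) * ?dW v) / (W p)\<^sup>2)) (at p)"
  proof -
    have "Q x $ i = (F x * a x $ i - E x * b x $ i) / W x" for x by (simp add: Q_def)
    then show ?thesis
      using has_derivative_divide'[OF has_derivative_diff[OF has_derivative_mult[OF dF has_derivative_nth[OF da, of i]]
          has_derivative_mult[OF dE has_derivative_nth[OF db, of i]]] dW] W_pos[of p]
      by (simp add: power2_eq_square add.commute)
  qed
  \<comment> \<open>Commuting partial derivatives leave three second derivatives, matching the
    parameters of \<open>divergence_identity\<close>.\<close>
  have q: "partial 2 a p = partial 1 b p"
    using partial_commute[of \<phi>] smooth by (simp add: smooth_def)
  have D: "?D \<noteq> 0" using discriminant_pos[of p] by simp
  have "mean_curvature_vector \<phi> p $ i = 0"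
    using minimal by (simp add: vanishing_mean_curvature_def)
  then show ?thesis
    using divergence_identity[OF D W_square, of "partial 1 a p $ i"
        "minkowski (partial 1 a p) (a p)" "minkowski (partial 1 a p) (b p)" "a p $ i" "b p $ i"
        "partial 1 b p $ i" "minkowski (partial 1 b p) (a p)" "minkowski (partial 1 b p) (b p)"
        "partial 2 b p $ i" "minkowski (partial 2 b p) (a p)" "minkowski (partial 2 b p) (b p)"]
    unfolding partial_eqI[OF dP] partial_eqI[OF dQ]
    unfolding mean_curvature_vector_def second_fundamental_form_def normal_part_def sum_2
      matrix_inv_induced_form partial_def[of _ a, symmetric] partial_def[of _ b, symmetric] q
    by (simp add: algebra_simps)
qed

lemma conjugate_exists:
  "\<exists>Y. \<forall>p. (Y has_derivative (\<lambda>v. v $ 2 *\<^sub>R P p - v $ 1 *\<^sub>R Q p)) (at p)"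
proof -
  have "\<exists>h. \<forall>p. (h has_derivative (\<lambda>v. v $ 2 * P p $ i - v $ 1 * Q p $ i)) (at p)" for i
    by (rule divergence_free_imp_conjugate)
       (use divergence_free class_C_PQ in \<open>auto simp: smooth_def intro!: class_C_nth\<close>)
  then have "\<forall>i. \<exists>h. \<forall>p. (h has_derivative (\<lambda>v. v $ 2 * P p $ i - v $ 1 * Q p $ i)) (at p)" ..
  from choice[OF this] obtain h
    where "\<And>i p. (h i has_derivative (\<lambda>v. v $ 2 * P p $ i - v $ 1 * Q p $ i)) (at p)"
    by blast
  then have "((\<lambda>x. \<chi> i. h i x) has_derivative (\<lambda>v. v $ 2 *\<^sub>R P p - v $ 1 *\<^sub>R Q p)) (at p)" for p
    by (intro has_derivative_vecI) simp
  then show ?thesis by blast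
qed

text \<open>\<open>- J / W\<close> is the squared length of the gradient of the time function in the
  induced form, so \<open>J > 0\<close> says that this gradient is timelike. \<open>v\<close> is the
  gradient rescaled to time component 1, and \<open>u\<close> is tangent without time
  component.\<close>

definition J where "J p = - (Q p $ 1 * b p $ 1 + P p $ 1 * a p $ 1)"
definition u where "u p = (1 / J p) *\<^sub>R (b p $ 1 *\<^sub>R a p - a p $ 1 *\<^sub>R b p)"
definition v where "v p = - (1 / J p) *\<^sub>R (P p $ 1 *\<^sub>R a p + Q p $ 1 *\<^sub>R b p)"

lemma frame:
  shows J_pos: "J p > 0" and u_time: "u p $ 1 = 0" and v_time: "v p $ 1 = 1"
    and u_orth_v: "u p $ 2 * v p $ 2 + u p $ 3 * v p $ 3 = 0"
    and u_v_unit: "(u p $ 2)\<^sup>2 + (u p $ 3)\<^sup>2 + (v p $ 2)\<^sup>2 + (v p $ 3)\<^sup>2 = 1"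
    and v_conj: "v p = - (1 / J p) *\<^sub>R (a p $ 1 *\<^sub>R P p + b p $ 1 *\<^sub>R Q p)"
    and u_conj: "u p = (1 / J p) *\<^sub>R (P p $ 1 *\<^sub>R Q p - Q p $ 1 *\<^sub>R P p)"
  using isothermal_frame[of "a p" "b p", folded E_def F_def G_def, folded W_def, folded P_def Q_def,
      folded J_def, folded u_def v_def, OF discriminant_pos]
  by blast+

text \<open>
  The chart is \<open>(Y\<^sup>0, \<phi>\<^sup>0)\<close> with \<open>\<partial>\<^sub>1 Y = - Q\<close> and \<open>\<partial>\<^sub>2 Y = P\<close>; its Jacobian determinant is \<open>J\<close> and the
  inverse of its derivative is \<open>dchart_inv\<close>.
\<close>

definition dchart_inv :: "real ^ 2 \<Rightarrow> real ^ 2 \<Rightarrow> real ^ 2" where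
  "dchart_inv p w = vector [(b p $ 1 * w $ 1 - P p $ 1 * w $ 2) / J p, - (a p $ 1 * w $ 1 + Q p $ 1 * w $ 2) / J p]"

lemma smooth_dchart_inv: "smooth (\<lambda>p. dchart_inv p w)"
proof -
  have nz: "J p \<noteq> 0" for p using J_pos[of p] by simp
  have J: "class_C k J" for k
    unfolding J_def[abs_def] by (intro class_C_intros class_C_coeffs class_C_PQ)
  have "\<forall>i. class_C k (\<lambda>p. dchart_inv p w $ i)" for k
    unfolding forall_2 dchart_inv_def vector_2
    by (intro conjI class_C_divide class_C_intros class_C_coeffs class_C_PQ J nz)
  then show ?thesis unfolding smooth_def by (blast intro: class_C_vecI)
qed

text \<open>The chain rule for \<phi> in the new coordinates: its derivatives along \<open>s\<close>
  and \<open>t\<close> are \<open>u\<close> and \<open>v\<close>.\<close>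

lemma dchart_inv_frame: "dchart_inv p w $ 1 *\<^sub>R a p + dchart_inv p w $ 2 *\<^sub>R b p = w $ 1 *\<^sub>R u p + w $ 2 *\<^sub>R v p"
  using J_pos[of p] by (simp add: dchart_inv_def u_def v_def vec_eq_iff field_simps)

text \<open>The same chain rule for the conjugate: expressing \<open>u\<close> and \<open>v\<close>
  through \<open>P\<close> and \<open>Q\<close> shows that passing to the conjugate exchanges
  them.\<close>

lemma dchart_inv_conj: "dchart_inv p w $ 2 *\<^sub>R P p - dchart_inv p w $ 1 *\<^sub>R Q p = w $ 1 *\<^sub>R v p + w $ 2 *\<^sub>R u p"
  using J_pos[of p] by (simp add: dchart_inv_def u_conj v_conj vec_eq_iff field_simps)

theorem isothermal_coordinates:
  assumes proper: "proper_map euclidean euclidean \<phi>"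
  shows "\<exists>(\<psi> :: real ^ 2 \<Rightarrow> real ^ 2) (\<gamma> :: real ^ 2 \<Rightarrow> real ^ 2).
           smooth_diffeomorphism \<psi> \<and>
           (\<forall>s t. (\<phi> \<circ> \<psi>) (vector [s, t])
                    = vector [t, \<gamma> (vector [s, t]) $ 1, \<gamma> (vector [s, t]) $ 2]) \<and>
           (\<forall>p. partial 1 \<gamma> p \<bullet> partial 2 \<gamma> p = 0 \<and>
                (norm (partial 1 \<gamma> p))\<^sup>2 + (norm (partial 2 \<gamma> p))\<^sup>2 = 1 \<and>
                partial 2 (partial 2 \<gamma>) p - partial 1 (partial 1 \<gamma>) p = 0)"
proof -
  obtain Y where Y: "\<And>p. (Y has_derivative (\<lambda>w. w $ 2 *\<^sub>R P p - w $ 1 *\<^sub>R Q p)) (at p)"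
    using conjugate_exists by blast
  have smooth_Y: "class_C k Y" for k
    using class_C_SucI[OF Y] class_C_SucD by (blast intro: class_C_intros class_C_PQ)
  have d\<phi>: "(\<phi> has_derivative (\<lambda>w. w $ 1 *\<^sub>R a p + w $ 2 *\<^sub>R b p)) (at p)" for p
    by (rule has_derivative_eq_rhs[OF smooth_has_derivative[OF smooth]])
       (rule ext, rule frechet_derivative_real2[OF smooth_has_derivative[OF smooth]])
  define f where "f p = (vector [Y p $ 1, \<phi> p $ 1] :: real ^ 2)" for p
  define f' where "f' p w = (vector [w $ 2 * P p $ 1 - w $ 1 * Q p $ 1, w $ 1 * a p $ 1 + w $ 2 * b p $ 1] :: real ^ 2)"
    for p and w :: "real ^ 2"
  have df: "(f has_derivative f' p) (at p)" for p
  proof (rule has_derivative_vecI)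
    have "\<forall>i. ((\<lambda>p. f p $ i) has_derivative (\<lambda>w. f' p w $ i)) (at p)"
      using has_derivative_nth[OF Y, of 1] has_derivative_nth[OF d\<phi>, of 1]
      by (simp add: forall_2 f_def f'_def)
    then show "((\<lambda>p. f p $ i) has_derivative (\<lambda>w. f' p w $ i)) (at p)" for i ..
  qed
  have inv: "dchart_inv p (f' p w) = w" for p w
    using J_pos[of p] by (simp add: dchart_inv_def f'_def vec_eq_iff forall_2 field_simps) (simp add: J_def algebra_simps)
  have lin: "linear (dchart_inv p)" for p
    by (intro linearI) (simp_all add: dchart_inv_def vec_eq_iff forall_2 algebra_simps add_divide_distrib diff_divide_distrib)
  have "class_C 0 (\<lambda>p. f' p w)" for w
  proof (rule class_C_vecI)
    have "\<forall>i. class_C 0 (\<lambda>p. f' p w $ i)"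
      unfolding forall_2 f'_def vector_2 by (intro conjI class_C_intros class_C_coeffs class_C_PQ)
    then show "class_C 0 (\<lambda>p. f' p w $ i)" for i ..
  qed
  then have cont_f': "continuous_on UNIV (\<lambda>p. f' p w)" for w by simp
  \<comment> \<open>The spatial parts of \<open>u\<close> and \<open>v\<close> have length at most 1
    and their time components are 0 and 1, so both norms are at most 2; each coordinate of
    \<open>f' p w\<close> is at most its norm, and 2 + 2 gives the constant.\<close>
  have bound: "norm (w $ 1 *\<^sub>R a p + w $ 2 *\<^sub>R b p) \<le> 4 * norm (f' p w)" for p w
  proof -
    let ?z = "f' p w"
    have n3: "(norm x)\<^sup>2 = (x $ 1)\<^sup>2 + (x $ 2)\<^sup>2 + (x $ 3)\<^sup>2" for x :: "real ^ 3"
      unfolding power2_norm_eq_inner by (simp add: inner_vec_def sum_3 power2_eq_square)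
    note sq = zero_le_power2[of "u p $ 2"] zero_le_power2[of "u p $ 3"]
      zero_le_power2[of "v p $ 2"] zero_le_power2[of "v p $ 3"]
    have "(u p $ 2)\<^sup>2 + (u p $ 3)\<^sup>2 \<le> 1"
      using u_v_unit[of p] sq by linarith
    moreover have "(v p $ 2)\<^sup>2 + (v p $ 3)\<^sup>2 \<le> 1"
      using u_v_unit[of p] sq by linarith
    ultimately have "(norm (u p))\<^sup>2 \<le> 2\<^sup>2" "(norm (v p))\<^sup>2 \<le> 2\<^sup>2"
      by (simp_all add: n3 u_time v_time)
    then have "norm (u p) \<le> 2" "norm (v p) \<le> 2"
      by (auto intro: power2_le_imp_le)
    have "w $ 1 *\<^sub>R a p + w $ 2 *\<^sub>R b p = ?z $ 1 *\<^sub>R u p + ?z $ 2 *\<^sub>R v p"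
      using dchart_inv_frame[of p ?z] by (simp add: inv)
    also have "norm \<dots> \<le> \<bar>?z $ 1\<bar> * norm (u p) + \<bar>?z $ 2\<bar> * norm (v p)"
      using norm_triangle_ineq[of "?z $ 1 *\<^sub>R u p" "?z $ 2 *\<^sub>R v p"] by simp
    also have "\<dots> \<le> norm ?z * 2 + norm ?z * 2"
      by (intro add_mono mult_mono component_le_norm_cart \<open>norm (u p) \<le> 2\<close> \<open>norm (v p) \<le> 2\<close>) auto
    finally show ?thesis by simp
  qed
  have "compact (\<phi> -` K)" if "compact K" for K
    using compactin_proper_map_preimage[OF proper] that by (simp add: vimage_def)
  from hadamard_bij[OF df cont_f' _ d\<phi> bound this]
  have bij: "bij f" and cont: "continuous_on UNIV (inv f)"
    using inv by (metis injI)+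
  define \<psi> where "\<psi> = inv f"
  have f_\<psi>: "f (\<psi> y) = y" for y
    using bij by (simp add: \<psi>_def bij_is_surj surj_f_inv_f)
  note inv_f = smooth_inv[OF bij cont df lin inv smooth_dchart_inv, folded \<psi>_def]
  have "inv \<psi> = f"
    using bij by (simp add: \<psi>_def inv_inv_eq)
  moreover have "smooth f"
  proof -
    have "\<forall>i. class_C k (\<lambda>p. f p $ i)" for k
      using smooth smooth_Y unfolding forall_2 f_def vector_2 smooth_def by (auto intro!: class_C_nth)
    then show ?thesis unfolding smooth_def by (blast intro: class_C_vecI)
  qed
  ultimately have "smooth_diffeomorphism \<psi>"
    using bij inv_f(1) bij_imp_bij_inv by (simp add: smooth_diffeomorphism_def \<psi>_def)
  define \<sigma> where "\<sigma> x = (vector [x $ 2, x $ 3] :: real ^ 2)" for x :: "real ^ 3"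
  have \<sigma>: "bounded_linear \<sigma>"
    unfolding linear_conv_bounded_linear[symmetric]
    by (intro linearI) (simp_all add: \<sigma>_def vec_eq_iff forall_2)
  define \<gamma> where "\<gamma> y = \<sigma> (\<phi> (\<psi> y))" for y
  \<comment> \<open>The spatial part of the conjugate in the new coordinates; its partial
    derivatives are those of \<gamma> in exchanged order.\<close>
  define \<zeta> where "\<zeta> y = \<sigma> (Y (\<psi> y))" for y
  have d\<gamma>: "(\<gamma> has_derivative (\<lambda>w. \<sigma> (w $ 1 *\<^sub>R u (\<psi> y) + w $ 2 *\<^sub>R v (\<psi> y)))) (at y)" for y
    using bounded_linear.has_derivative[OF \<sigma> has_derivative_compose[OF inv_f(2) d\<phi>]]
    by (simp add: \<gamma>_def[abs_def] dchart_inv_frame)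
  have d\<zeta>: "(\<zeta> has_derivative (\<lambda>w. \<sigma> (w $ 1 *\<^sub>R v (\<psi> y) + w $ 2 *\<^sub>R u (\<psi> y)))) (at y)" for y
    using bounded_linear.has_derivative[OF \<sigma> has_derivative_compose[OF inv_f(2) Y]]
    by (simp add: \<zeta>_def[abs_def] dchart_inv_conj)
  have p\<gamma>: "partial 1 \<gamma> = (\<lambda>y. \<sigma> (u (\<psi> y)))" "partial 2 \<gamma> = (\<lambda>y. \<sigma> (v (\<psi> y)))"
    and p\<zeta>: "partial 1 \<zeta> = partial 2 \<gamma>" "partial 2 \<zeta> = partial 1 \<gamma>"
    by (simp_all add: fun_eq_iff partial_eqI[OF d\<gamma>] partial_eqI[OF d\<zeta>] axis_def)
  have "class_C 2 \<psi>"
    using inv_f(1) unfolding smooth_def ..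
  then have "class_C 2 \<zeta>"
    unfolding \<zeta>_def[abs_def]
    by (rule class_C_compose[OF class_C_bounded_linear[OF \<sigma>] class_C_compose[OF smooth_Y]])
  from partial_commute[OF this, of 2 1]
  have wave: "partial 2 (partial 2 \<gamma>) p = partial 1 (partial 1 \<gamma>) p" for p
    by (simp add: p\<zeta>)
  have "(\<phi> \<circ> \<psi>) (vector [s, t]) = vector [t, \<gamma> (vector [s, t]) $ 1, \<gamma> (vector [s, t]) $ 2]" for s t
  proof -
    have "\<phi> (\<psi> (vector [s, t])) $ 1 = t"
      using f_\<psi>[of "vector [s, t]"] by (simp add: f_def vec_eq_iff forall_2)
    then show ?thesis by (simp add: vec_eq_iff forall_3 \<gamma>_def \<sigma>_def)
  qed
  moreover have "partial 1 \<gamma> p \<bullet> partial 2 \<gamma> p = 0 \<and>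
      (norm (partial 1 \<gamma> p))\<^sup>2 + (norm (partial 2 \<gamma> p))\<^sup>2 = 1" for p
    using u_orth_v[of "\<psi> p"] u_v_unit[of "\<psi> p"]
    unfolding p\<gamma> power2_norm_eq_inner
    by (simp add: \<sigma>_def inner_vec_def sum_2 power2_eq_square)
  ultimately show ?thesis
    using \<open>smooth_diffeomorphism \<psi>\<close> wave by (intro exI[of _ \<psi>] exI[of _ \<gamma>]) simp
qed

end

theorem lemma2p2:
  fixes \<phi> :: "real ^ 2 \<Rightarrow> real ^ 3"
  assumes "smooth \<phi>"
    and "proper_map euclidean euclidean \<phi>"
    and "immersion \<phi>"
    and "timelike \<phi>"
    and "vanishing_mean_curvature \<phi>"
  shows "\<exists>(\<psi> :: real ^ 2 \<Rightarrow> real ^ 2) (\<gamma> :: real ^ 2 \<Rightarrow> real ^ 2).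
           smooth_diffeomorphism \<psi> \<and>
           (\<forall>s t. (\<phi> \<circ> \<psi>) (vector [s, t])
                    = vector [t, \<gamma> (vector [s, t]) $ 1, \<gamma> (vector [s, t]) $ 2]) \<and>
           (\<forall>p. partial 1 \<gamma> p \<bullet> partial 2 \<gamma> p = 0 \<and>
                (norm (partial 1 \<gamma> p))\<^sup>2 + (norm (partial 2 \<gamma> p))\<^sup>2 = 1 \<and>
                partial 2 (partial 2 \<gamma>) p - partial 1 (partial 1 \<gamma>) p = 0)"
proof -
  interpret timelike_minimal \<phi>
    by unfold_locales (use assms in auto)
  show ?thesis
    by (rule isothermal_coordinates[OF assms(2)])
qed

end
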